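(* Let $L$ be a locally compact group, let $(G_i)_{i\in I}$ be a family of groups, and let $\varphi\colon L\to \ast_{i\in I}G_i$ be an abstract group homomorphism into their free product, which is equipped with the discrete topology. Then $\varphi$ is continuous, or the image $\varphi(L)$ is conjugate to a subgroup of one of the factors $G_i$.
   Context: All topological groups are assumed Hausdorff. An abstract group homomorphism is a group homomorphism that is not assumed to be continuous. *)

theory Defs
  imports "HOL-Analysis.Analysis" "HOL-Algebra.Coset"
begin

section \<open>Topological groups\<close>

text \<open>Topological groups are Hausdorff by convention.\<close>

locale topological_group = group L for L (structure) +
  fixes T
  assumes topspace_eq: "topspace T = carrier L"
    and Hausdorff: "Hausdorff_space T"
    and continuous_mult: "continuous_map (prod_topology T T) T (\<lambda>(x, y). x \<otimes> y)"
    and continuous_inv: "continuous_map T T (\<lambda>x. inv x)"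

locale locally_compact_group = topological_group +
  assumes locally_compact: "locally_compact_space T"


section \<open>Free products\<close>

text \<open>
  The free product of a family \<open>(G i)\<close>, \<open>i \<in> I\<close>, is realised on the set of reduced words: finite
  sequences of syllables \<open>(i, x)\<close> with \<open>x\<close> a nontrivial element of \<open>G i\<close> in which neighbouring
  syllables belong to different factors. The product of two reduced words is their concatenation
  followed by reduction. That this is the coproduct of the family in the category of groups is
  proved at the end of the theory.
\<close>

definition reduced_words :: "'i set \<Rightarrow> ('i \<Rightarrow> ('a, 'b) monoid_scheme) \<Rightarrow> ('i \<times> 'a) list set" where
  "reduced_words I G =
     {w. (\<forall>(i, x) \<in> set w. i \<in> I \<and> x \<in> carrier (G i) \<and> x \<noteq> \<one>\<^bsub>G i\<^esub>) \<and> distinct_adj (map fst w)}"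

text \<open>
  Multiplication of a reduced word from the left by an element \<open>x\<close> of \<open>G i\<close>, where \<open>x\<close> may be trivial.
\<close>

fun syllable_mult :: "('i \<Rightarrow> ('a, 'b) monoid_scheme) \<Rightarrow> 'i \<times> 'a \<Rightarrow> ('i \<times> 'a) list \<Rightarrow> ('i \<times> 'a) list" where
  "syllable_mult G (i, x) [] = (if x = \<one>\<^bsub>G i\<^esub> then [] else [(i, x)])"
| "syllable_mult G (i, x) ((j, y) # w) =
     (if x = \<one>\<^bsub>G i\<^esub> then (j, y) # w
      else if i \<noteq> j then (i, x) # (j, y) # w
      else if x \<otimes>\<^bsub>G i\<^esub> y = \<one>\<^bsub>G i\<^esub> then w
      else (i, x \<otimes>\<^bsub>G i\<^esub> y) # w)"

definition free_product :: "'i set \<Rightarrow> ('i \<Rightarrow> ('a, 'b) monoid_scheme) \<Rightarrow> ('i \<times> 'a) list monoid" where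
  "free_product I G =
     \<lparr>carrier = reduced_words I G, mult = \<lambda>u v. foldr (syllable_mult G) u v, one = []\<rparr>"

definition free_product_incl :: "('i \<Rightarrow> ('a, 'b) monoid_scheme) \<Rightarrow> 'i \<Rightarrow> 'a \<Rightarrow> ('i \<times> 'a) list" where
  "free_product_incl G i x = (if x = \<one>\<^bsub>G i\<^esub> then [] else [(i, x)])"


subsection \<open>The free product is a group\<close>

lemma free_product_simps [simp]:
  "carrier (free_product I G) = reduced_words I G"
  "u \<otimes>\<^bsub>free_product I G\<^esub> v = foldr (syllable_mult G) u v"
  "\<one>\<^bsub>free_product I G\<^esub> = []"
  by (simp_all add: free_product_def)

lemma Nil_reduced_words [simp]: "[] \<in> reduced_words I G"
  by (simp add: reduced_words_def)

lemma Cons_reduced_words_iff: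
  "(i, x) # w \<in> reduced_words I G \<longleftrightarrow>
     i \<in> I \<and> x \<in> carrier (G i) \<and> x \<noteq> \<one>\<^bsub>G i\<^esub> \<and> w \<in> reduced_words I G \<and> (w = [] \<or> fst (hd w) \<noteq> i)"
  by (cases w) (auto simp: reduced_words_def)

lemma syllable_mult_one [simp]: "syllable_mult G (i, \<one>\<^bsub>G i\<^esub>) w = w"
  by (cases "(G, (i, \<one>\<^bsub>G i\<^esub>), w)" rule: syllable_mult.cases) auto

lemma syllable_mult_Cons:
  assumes "(i, x) # w \<in> reduced_words I G"
  shows "syllable_mult G (i, x) w = (i, x) # w"
  using assms by (cases w) (auto simp: Cons_reduced_words_iff)

locale group_family =
  fixes I :: "'i set" and G :: "'i \<Rightarrow> ('a, 'b) monoid_scheme"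
  assumes group_factor: "i \<in> I \<Longrightarrow> group (G i)"
begin

lemma syllable_mult_closed:
  assumes "i \<in> I" "x \<in> carrier (G i)" "w \<in> reduced_words I G"
  shows "syllable_mult G (i, x) w \<in> reduced_words I G"
proof -
  interpret group "G i" using group_factor assms by blast
  show ?thesis
    using assms by (cases w) (auto simp: Cons_reduced_words_iff)
qed

lemma syllable_mult_same:
  assumes "i \<in> I" "x \<in> carrier (G i)" "y \<in> carrier (G i)" "w \<in> reduced_words I G"
  shows "syllable_mult G (i, x) (syllable_mult G (i, y) w) = syllable_mult G (i, x \<otimes>\<^bsub>G i\<^esub> y) w"
proof -
  interpret group "G i" using group_factor assms by blast
  show ?thesis
  proof (cases "x = \<one>\<^bsub>G i\<^esub> \<or> y = \<one>\<^bsub>G i\<^esub>")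
    case True
    then show ?thesis using assms by auto
  next
    case nontrivial: False
    show ?thesis
    proof (cases "w = [] \<or> fst (hd w) \<noteq> i")
      case True
      then show ?thesis using assms nontrivial by (cases w) auto
    next
      case False
      then obtain z v where w: "w = (i, z) # v" by (cases w) auto
      then have z: "z \<in> carrier (G i)" "z \<noteq> \<one>\<^bsub>G i\<^esub>" and v: "v = [] \<or> fst (hd v) \<noteq> i"
        using assms by (auto simp: Cons_reduced_words_iff)
      have assoc: "x \<otimes>\<^bsub>G i\<^esub> y \<otimes>\<^bsub>G i\<^esub> z = x \<otimes>\<^bsub>G i\<^esub> (y \<otimes>\<^bsub>G i\<^esub> z)"
        using assms z by (simp add: m_assoc)
      show ?thesis
      proof (cases "y \<otimes>\<^bsub>G i\<^esub> z = \<one>\<^bsub>G i\<^esub>")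
        case True
        have "x \<otimes>\<^bsub>G i\<^esub> y \<noteq> \<one>\<^bsub>G i\<^esub>"
          if "x \<noteq> z"
          using that True assms z by (metis inv_equality inv_inv)
        moreover have "x \<otimes>\<^bsub>G i\<^esub> y = \<one>\<^bsub>G i\<^esub>" if "x = z"
          using that True assms z by (metis inv_comm)
        ultimately show ?thesis
          using True w v z nontrivial assoc assms by (cases v) auto
      next
        case False
        have "x \<otimes>\<^bsub>G i\<^esub> (y \<otimes>\<^bsub>G i\<^esub> z) = z" if "x \<otimes>\<^bsub>G i\<^esub> y = \<one>\<^bsub>G i\<^esub>"
          using that assoc z by simp
        then show ?thesis
          using False w v z nontrivial assoc assms by auto
      qed
    qed
  qed
qed

lemma foldr_syllable_mult_closed:
  "u \<in> reduced_words I G \<Longrightarrow> v \<in> reduced_words I G \<Longrightarrow> foldr (syllable_mult G) u v \<in> reduced_words I G"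
  by (induction u) (auto simp: Cons_reduced_words_iff intro!: syllable_mult_closed)

lemma foldr_syllable_mult_step:
  assumes "i \<in> I" "x \<in> carrier (G i)" "v \<in> reduced_words I G" "w \<in> reduced_words I G"
  shows "foldr (syllable_mult G) (syllable_mult G (i, x) v) w =
           syllable_mult G (i, x) (foldr (syllable_mult G) v w)"
proof (cases v)
  case Nil
  then show ?thesis by simp
next
  case (Cons s v')
  then obtain j y where v: "v = (j, y) # v'" by (cases s) auto
  with assms have y: "j \<in> I" "y \<in> carrier (G j)" and v': "v' \<in> reduced_words I G"
    by (auto simp: Cons_reduced_words_iff)
  have "syllable_mult G (i, x) (syllable_mult G (i, y) (foldr (syllable_mult G) v' w)) =
      syllable_mult G (i, x \<otimes>\<^bsub>G i\<^esub> y) (foldr (syllable_mult G) v' w)" if "i = j"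
    using that y v' assms by (intro syllable_mult_same foldr_syllable_mult_closed) auto
  then show ?thesis
    using v by auto
qed

lemma foldr_syllable_mult_assoc:
  assumes "u \<in> reduced_words I G" "v \<in> reduced_words I G" "w \<in> reduced_words I G"
  shows "foldr (syllable_mult G) (foldr (syllable_mult G) u v) w =
           foldr (syllable_mult G) u (foldr (syllable_mult G) v w)"
  using assms
  by (induction u)
     (auto simp: Cons_reduced_words_iff foldr_syllable_mult_step foldr_syllable_mult_closed)

lemma foldr_syllable_mult_left_inverse:
  "w \<in> reduced_words I G \<Longrightarrow> \<exists>v \<in> reduced_words I G. foldr (syllable_mult G) v w = []"
proof (induction w)
  case Nil
  then show ?case by (intro bexI[of _ "[]"]) auto
next
  case (Cons s w)
  obtain i x where s: "s = (i, x)" by (cases s)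
  with Cons.prems have x: "i \<in> I" "x \<in> carrier (G i)" "x \<noteq> \<one>\<^bsub>G i\<^esub>" and w: "w \<in> reduced_words I G"
    by (auto simp: Cons_reduced_words_iff)
  interpret group "G i" using group_factor x by blast
  obtain v where v: "v \<in> reduced_words I G" "foldr (syllable_mult G) v w = []"
    using Cons.IH w by blast
  let ?t = "[(i, inv\<^bsub>G i\<^esub> x)]"
  have t: "?t \<in> reduced_words I G"
    using x by (auto simp: Cons_reduced_words_iff)
  have "foldr (syllable_mult G) ?t (s # w) = w"
    using s x by (auto simp: inv_eq_1_iff)
  then have "foldr (syllable_mult G) (foldr (syllable_mult G) v ?t) (s # w) = []"
    using foldr_syllable_mult_assoc[OF v(1) t Cons.prems] v by simp
  then show ?case
    using foldr_syllable_mult_closed[OF v(1) t] by blast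
qed

theorem group_free_product: "group (free_product I G)"
  by (rule groupI)
     (simp_all add: foldr_syllable_mult_closed foldr_syllable_mult_assoc
        foldr_syllable_mult_left_inverse)


subsection \<open>Universal property\<close>

lemma free_product_incl_closed:
  "i \<in> I \<Longrightarrow> x \<in> carrier (G i) \<Longrightarrow> free_product_incl G i x \<in> reduced_words I G"
  by (simp add: free_product_incl_def Cons_reduced_words_iff)

theorem free_product_incl_hom:
  assumes "i \<in> I"
  shows "free_product_incl G i \<in> hom (G i) (free_product I G)"
  using assms by (intro homI) (auto simp: free_product_incl_closed, auto simp: free_product_incl_def
      group.is_monoid group_factor monoid.l_one monoid.r_one)

lemma free_product_incl_inj: "inj_on (free_product_incl G i) (carrier (G i))"
  by (auto simp: inj_on_def free_product_incl_def split: if_splits)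

theorem free_product_hom_exists:
  assumes "group H" and f: "\<And>i. i \<in> I \<Longrightarrow> f i \<in> hom (G i) H"
  shows "\<exists>h \<in> hom (free_product I G) H. \<forall>i \<in> I. \<forall>x \<in> carrier (G i). h (free_product_incl G i x) = f i x"
proof -
  interpret H: group H by fact
  define h where "h w = foldr (\<lambda>(i, x) a. f i x \<otimes>\<^bsub>H\<^esub> a) w \<one>\<^bsub>H\<^esub>" for w
  have h_Nil: "h [] = \<one>\<^bsub>H\<^esub>" and h_Cons: "h ((i, x) # w) = f i x \<otimes>\<^bsub>H\<^esub> h w" for i x w
    by (simp_all add: h_def)
  have f_closed: "f i x \<in> carrier H" if "i \<in> I" "x \<in> carrier (G i)" for i x
    using f[OF that(1)] that(2) by (auto simp: hom_def)
  have f_mult: "f i (x \<otimes>\<^bsub>G i\<^esub> y) = f i x \<otimes>\<^bsub>H\<^esub> f i y"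
    if "i \<in> I" "x \<in> carrier (G i)" "y \<in> carrier (G i)" for i x y
    using f[OF that(1)] that by (auto simp: hom_def)
  have f_one: "f i \<one>\<^bsub>G i\<^esub> = \<one>\<^bsub>H\<^esub>" if "i \<in> I" for i
    using f[OF that] group_factor[OF that] \<open>group H\<close> hom_one by blast
  have h_closed: "h w \<in> carrier H" if "w \<in> reduced_words I G" for w
    using that by (induction w) (auto simp: h_Nil h_Cons Cons_reduced_words_iff f_closed)
  have h_step: "h (syllable_mult G (i, x) w) = f i x \<otimes>\<^bsub>H\<^esub> h w"
    if ix: "i \<in> I" "x \<in> carrier (G i)" and w: "w \<in> reduced_words I G" for i x w
  proof (cases w)
    case Nil
    then show ?thesis using ix by (simp add: h_Nil h_Cons f_one f_closed)
  next
    case (Cons s v)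
    then obtain j y where wv: "w = (j, y) # v" by (cases s) auto
    with w have y: "j \<in> I" "y \<in> carrier (G j)" and v: "v \<in> reduced_words I G"
      by (auto simp: Cons_reduced_words_iff)
    show ?thesis
    proof (cases "x = \<one>\<^bsub>G i\<^esub> \<or> i \<noteq> j")
      case True
      then show ?thesis
        using wv ix y v w by (auto simp: h_Cons f_one f_closed h_closed)
    next
      case False
      have "f i x \<otimes>\<^bsub>H\<^esub> (f i y \<otimes>\<^bsub>H\<^esub> h v) = f i (x \<otimes>\<^bsub>G i\<^esub> y) \<otimes>\<^bsub>H\<^esub> h v"
        using False ix y v by (simp add: f_mult f_closed h_closed H.m_assoc)
      then show ?thesis
        using False wv ix v by (auto simp: h_Cons f_one h_closed)
    qed
  qed
  have "h (foldr (syllable_mult G) u v) = h u \<otimes>\<^bsub>H\<^esub> h v"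
    if "u \<in> reduced_words I G" "v \<in> reduced_words I G" for u v
    using that
    by (induction u)
       (auto simp: h_Nil h_Cons Cons_reduced_words_iff h_closed h_step f_closed H.m_assoc
          foldr_syllable_mult_closed)
  then have "h \<in> hom (free_product I G) H"
    by (auto simp: hom_def h_closed)
  moreover have "h (free_product_incl G i x) = f i x" if "i \<in> I" "x \<in> carrier (G i)" for i x
    using that by (simp add: free_product_incl_def h_Nil h_Cons f_one f_closed)
  ultimately show ?thesis by blast
qed

theorem free_product_hom_unique:
  assumes "group H" "h \<in> hom (free_product I G) H" "h' \<in> hom (free_product I G) H"
    and eq: "\<And>i x. i \<in> I \<Longrightarrow> x \<in> carrier (G i) \<Longrightarrow> h (free_product_incl G i x) = h' (free_product_incl G i x)"
    and "w \<in> carrier (free_product I G)"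
  shows "h w = h' w"
proof -
  have "w \<in> reduced_words I G" using assms by simp
  then show ?thesis
  proof (induction w)
    case Nil
    show ?case
      using hom_one[OF assms(2) group_free_product \<open>group H\<close>]
        hom_one[OF assms(3) group_free_product \<open>group H\<close>] by simp
  next
    case (Cons s w)
    obtain i x where s: "s = (i, x)" by (cases s)
    with Cons.prems have x: "i \<in> I" "x \<in> carrier (G i)" "x \<noteq> \<one>\<^bsub>G i\<^esub>" and w: "w \<in> reduced_words I G"
      by (auto simp: Cons_reduced_words_iff)
    let ?t = "free_product_incl G i x"
    have t: "?t \<in> reduced_words I G" using x free_product_incl_closed by blast
    have sw: "s # w = ?t \<otimes>\<^bsub>free_product I G\<^esub> w"
      using Cons.prems s x syllable_mult_Cons[of i x w I G] by (simp add: free_product_incl_def)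
    have "h (s # w) = h ?t \<otimes>\<^bsub>H\<^esub> h w" "h' (s # w) = h' ?t \<otimes>\<^bsub>H\<^esub> h' w"
      using sw t w assms(2,3) hom_mult by fastforce+
    then show ?case
      using Cons.IH w eq x by simp
  qed
qed

end

end

theory Submission
  imports Defs
begin

text \<open>
  The free product \<open>F\<close> acts on its Bass-Serre tree with trivial edge stabilisers. If the edges are
  given the length \<open>1/2\<close>, the number of syllables of a reduced word is the distance by which it
  displaces a base vertex with trivial stabiliser. The tree itself is replaced by a few axioms on the
  length function, which turn the geometric steps into linear arithmetic with the four-point
  condition. An element \<open>x\<close> is called hyperbolic if \<open>xx\<close> is longer than \<open>x\<close>; its powers then grow
  linearly. Every other element is elliptic: it fixes a vertex, and if \<open>x \<noteq> 1\<close>, this vertex is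
  unique and \<open>x\<close> is conjugate into the factor that belongs to it.

  The first half of the proof shows that the identity of \<open>L\<close> has a neighbourhood without
  hyperbolic images (\<open>nonhyperbolic_neighbourhood\<close>). It extends an argument that Dudley used for
  homomorphisms to the integers. If every neighbourhood of the identity contains elements with
  hyperbolic image, then one can choose such elements \<open>x\<^sub>n\<close> and exponents \<open>r\<^sub>n\<close> one after the other,
  the \<open>x\<^sub>n\<close> so small that the equations
  \<open>y\<^sub>n = x\<^sub>n\<^sup>2\<^sup>0 y\<^sub>n\<^sub>+\<^sub>1\<^sup>r x\<^sub>n\<^sup>1\<^sup>0 y\<^sub>n\<^sub>+\<^sub>1\<^sup>r\<close> with \<open>r = r\<^sub>n\<close> have a common solution \<open>(y\<^sub>n)\<close> in a compact set.
  For homomorphisms to the integers the simpler equations \<open>y\<^sub>n = x\<^sub>n y\<^sub>n\<^sub>+\<^sub>1\<^sup>r\<close> suffice. Here they do not,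
  since the image of \<open>y\<^sub>n\<^sub>+\<^sub>1\<close> may be elliptic, and then its powers do not grow. The word above is
  chosen so that its value is hyperbolic for every \<open>y\<^sub>n\<^sub>+\<^sub>1\<close> (\<open>test_word_elliptic\<close>,
  \<open>test_word_growth\<close>). Hence all the \<open>\<phi> y\<^sub>n\<close> are hyperbolic, and for hyperbolic arguments
  the value of the word is at least as long as the argument and as \<open>r\<^sub>n\<close>, up to a constant that
  depends only on \<open>x\<^sub>n\<close> and is therefore known when \<open>r\<^sub>n\<close> is chosen. With the \<open>r\<^sub>n\<close> large enough,
  \<open>\<phi> y\<^sub>0\<close> would be longer than every natural number.

  The second half (\<open>open_kernel_or_fixed_point\<close>) looks at fixed vertices. Let \<open>V\<close> be a neighbourhood
  of the identity such that all products of two elements of \<open>V\<close> have elliptic image. Two nontrivial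
  elliptic elements with elliptic product fix the same vertex (\<open>elliptic_common_fixed_point\<close>), so
  \<open>\<phi> V\<close> fixes a vertex \<open>p\<close>. If \<open>\<phi>\<close> is not continuous,
  it is trivial on no neighbourhood, so for every \<open>l\<close> the intersection of \<open>V\<close> with its conjugate
  \<open>l V l\<^sup>-\<^sup>1\<close> contains an element with nontrivial image. That image fixes \<open>p\<close> and \<open>\<phi> l p\<close>, which
  must therefore be equal. So \<open>\<phi> L\<close> fixes \<open>p\<close>, and it is conjugate to a subgroup of a factor.
\<close>

section \<open>Groups with a tree-like length function\<close>

text \<open>
  The group is thought of as the orbit of a base vertex in a tree, on which it acts freely. The
  ultrametric inequality is the tree condition for the Gromov products at the base
  vertex, here doubled to keep them integral. The prefixes put an orbit point at every integral
  distance along a geodesic between orbit points. In the last axiom \<open>x\<close> rotates the tree about a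
  vertex at distance \<open>1/2\<close> from the base vertex; as edge stabilisers are trivial, the geodesics
  from the base vertex to \<open>y\<close> and to \<open>x y\<close> separate not later than there.
\<close>
locale tree_length_group = group G for G (structure) +
  fixes len :: "'a \<Rightarrow> int"
  assumes len_eq_0_iff: "x \<in> carrier G \<Longrightarrow> len x = 0 \<longleftrightarrow> x = \<one>"
    and len_inv: "x \<in> carrier G \<Longrightarrow> len (inv x) = len x"
    and len_ultrametric: "\<lbrakk>x \<in> carrier G; y \<in> carrier G; z \<in> carrier G\<rbrakk> \<Longrightarrow>
      min (len x + len y - len (inv x \<otimes> y)) (len y + len z - len (inv y \<otimes> z))
        \<le> len x + len z - len (inv x \<otimes> z)"
    and len_prefix: "\<lbrakk>x \<in> carrier G; 0 \<le> k; k \<le> len x\<rbrakk> \<Longrightarrow>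
      \<exists>z \<in> carrier G. len z = k \<and> len (inv z \<otimes> x) = len x - k"
    and len_syllable: "\<lbrakk>x \<in> carrier G; y \<in> carrier G; len x = 1\<rbrakk> \<Longrightarrow>
      len (x \<otimes> y) + len y - 1 \<le> len (inv y \<otimes> (x \<otimes> y))"
begin

lemma inv_cancel [simp]:
  assumes "x \<in> carrier G" "y \<in> carrier G"
  shows "inv x \<otimes> (x \<otimes> y) = y" "x \<otimes> (inv x \<otimes> y) = y"
  using assms by (simp_all flip: m_assoc)

lemmas group_rules = m_assoc inv_mult_group

definition gap :: "'a \<Rightarrow> 'a \<Rightarrow> int" where
  "gap x y = len (inv x \<otimes> y)"

lemma len_one [simp]: "len \<one> = 0"
  using len_eq_0_iff by simp

lemma gap_one [simp]: "x \<in> carrier G \<Longrightarrow> gap \<one> x = len x" "x \<in> carrier G \<Longrightarrow> gap x \<one> = len x"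
  by (simp_all add: gap_def len_inv)

lemma gap_sym: "\<lbrakk>x \<in> carrier G; y \<in> carrier G\<rbrakk> \<Longrightarrow> gap x y = gap y x"
  unfolding gap_def using len_inv[of "inv x \<otimes> y"] by (simp add: group_rules)

lemma gap_eq_0_iff: "\<lbrakk>x \<in> carrier G; y \<in> carrier G\<rbrakk> \<Longrightarrow> gap x y = 0 \<longleftrightarrow> x = y"
  unfolding gap_def using len_eq_0_iff[of "inv x \<otimes> y"]
  by (metis inv_closed inv_solve_left m_closed one_closed r_one)

lemma gap_left:
  "\<lbrakk>g \<in> carrier G; x \<in> carrier G; y \<in> carrier G\<rbrakk> \<Longrightarrow> gap (g \<otimes> x) (g \<otimes> y) = gap x y"
  by (simp add: gap_def group_rules)

lemma gap_four_point:
  assumes "x \<in> carrier G" "y \<in> carrier G" "z \<in> carrier G" "w \<in> carrier G"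
  shows "gap x y + gap z w \<le> max (gap x z + gap y w) (gap x w + gap y z)"
proof -
  have *: "gap x y = gap (inv w \<otimes> x) (inv w \<otimes> y)"
    if "x \<in> carrier G" "y \<in> carrier G" for x y
    using gap_left[of "inv w" x y] assms that by simp
  have "gap z w = len (inv w \<otimes> z)" "gap x w = len (inv w \<otimes> x)" "gap y w = len (inv w \<otimes> y)"
    using assms gap_sym by (auto simp: gap_def)
  moreover have "gap z y = gap y z" using assms gap_sym by blast
  ultimately show ?thesis
    using len_ultrametric[of "inv w \<otimes> x" "inv w \<otimes> z" "inv w \<otimes> y"] assms *[of x y] *[of x z] *[of z y]
    unfolding gap_def[symmetric] by (simp add: min_def max_def split: if_splits)
qed

lemma gap_triangle:
  assumes "x \<in> carrier G" "y \<in> carrier G" "z \<in> carrier G"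
  shows "gap x z \<le> gap x y + gap y z"
  using gap_four_point[of x z y y] assms gap_eq_0_iff[of y y] gap_sym[of y z] by simp

lemma gap_nonneg: "\<lbrakk>x \<in> carrier G; y \<in> carrier G\<rbrakk> \<Longrightarrow> 0 \<le> gap x y"
  using gap_triangle[of x y x] gap_eq_0_iff[of x x] gap_sym[of x y] by simp

lemma len_nonneg: "x \<in> carrier G \<Longrightarrow> 0 \<le> len x"
  using gap_nonneg[of \<one> x] by simp

lemma len_mult: "\<lbrakk>x \<in> carrier G; y \<in> carrier G\<rbrakk> \<Longrightarrow> len (x \<otimes> y) \<le> len x + len y"
  using gap_triangle[of \<one> x "x \<otimes> y"] by (simp add: gap_def)

lemma len_mult_ge:
  assumes "x \<in> carrier G" "y \<in> carrier G"
  shows "len x - len y \<le> len (x \<otimes> y)" "len y - len x \<le> len (x \<otimes> y)"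
  using len_mult[of "x \<otimes> y" "inv y"] len_mult[of "inv x" "x \<otimes> y"] assms
  by (simp_all add: group_rules len_inv)

text \<open>
  The tripod spanned by \<open>a\<close>, \<open>b\<close> and \<open>c\<close> has its centre on one side of \<open>z\<close>, so the geodesic from \<open>c\<close>
  to the end on the other side passes through \<open>z\<close>. Most later computations of distances are
  instances of this formula.
\<close>
lemma gap_between:
  assumes "a \<in> carrier G" "b \<in> carrier G" "c \<in> carrier G" "z \<in> carrier G"
    and "gap a z + gap z b = gap a b"
  shows "gap c z = max (gap c a - gap a z) (gap c b - gap z b)"
  using gap_four_point[of c z a b] gap_triangle[of c z a] gap_triangle[of c z b] assms
    gap_sym[of z a] gap_sym[of z b]
  by simp

lemma between_unique:
  assumes "a \<in> carrier G" "b \<in> carrier G" "y \<in> carrier G" "z \<in> carrier G"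
    and "gap a y + gap y b = gap a b" "gap a z + gap z b = gap a b" "gap a y = gap a z"
  shows "y = z"
proof -
  have "gap y z = 0"
    using gap_between[of a b y z] assms gap_sym[of a y] by simp
  then show ?thesis using gap_eq_0_iff assms by blast
qed

section \<open>Hyperbolic and elliptic elements\<close>

text \<open>
  For a hyperbolic \<open>x\<close> this is the distance by which \<open>x\<close> shifts its axis, and \<open>axis_offset\<close> below is
  twice the distance of the base vertex from that axis. For other \<open>x\<close> the value is not positive
  and has no such meaning.
\<close>
definition trans_length :: "'a \<Rightarrow> int" where
  "trans_length x = len (x \<otimes> x) - len x"

definition axis_offset :: "'a \<Rightarrow> int" where
  "axis_offset x = len x - trans_length x"

definition hyperbolic :: "'a \<Rightarrow> bool" where
  "hyperbolic x \<longleftrightarrow> 0 < trans_length x"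

lemma axis_offset_nonneg: "x \<in> carrier G \<Longrightarrow> 0 \<le> axis_offset x"
  using len_mult[of x x] by (simp add: axis_offset_def trans_length_def)

lemma trans_length_inv: "x \<in> carrier G \<Longrightarrow> trans_length (inv x) = trans_length x"
  by (simp add: trans_length_def len_inv flip: inv_mult_group)

lemma axis_offset_inv: "x \<in> carrier G \<Longrightarrow> axis_offset (inv x) = axis_offset x"
  by (simp add: axis_offset_def trans_length_inv len_inv)

lemma gap_int_pow: "x \<in> carrier G \<Longrightarrow> gap (x [^] (i::int)) (x [^] (j::int)) = len (x [^] (j - i))"
proof -
  assume x: "x \<in> carrier G"
  have "inv (x [^] i) \<otimes> x [^] j = x [^] (- i + j)"
    using x by (simp add: int_pow_neg int_pow_mult del: add_uminus_conv_diff uminus_add_conv_diff)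
  then show ?thesis by (simp add: gap_def)
qed

text \<open>
  By the four-point condition for \<open>1\<close>, \<open>x\<close>, \<open>x\<^sup>k\<close>, \<open>x\<^sup>k\<^sup>+\<^sup>1\<close> the difference of consecutive lengths
  stays constant once it is positive.
\<close>
lemma len_pow:
  assumes x: "x \<in> carrier G" and h: "hyperbolic x" and "0 < i"
  shows "len (x [^] (i::int)) = axis_offset x + i * trans_length x"
proof -
  have "len (x [^] (int n + 1)) = axis_offset x + (int n + 1) * trans_length x \<and>
        len (x [^] (int n + 2)) = axis_offset x + (int n + 2) * trans_length x" for n
  proof (induction n)
    case 0
    have "x [^] (2::int) = x \<otimes> x" using int_pow_mult[of x 1 1] x by simp
    then show ?case using x by (simp add: axis_offset_def trans_length_def)
  next
    case (Suc n)
    let ?p = "\<lambda>i::int. x [^] i"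
    define N where "N = int n"
    have N: "0 \<le> N" by (simp add: N_def)
    note fp = gap_four_point[of "?p 0" "?p (N+3)" "?p 1" "?p (N+2)"]
      gap_four_point[of "?p 0" "?p (N+2)" "?p 1" "?p (N+3)"]
    have l1: "len x = axis_offset x + trans_length x" by (simp add: axis_offset_def)
    have ih: "len (?p (N+1)) = axis_offset x + (N+1) * trans_length x" "len (?p (N+2)) = axis_offset x + (N+2) * trans_length x"
      using Suc by (auto simp: N_def)
    have "(N+1) * trans_length x \<ge> trans_length x" using N h by (simp add: hyperbolic_def)
    then have "len (?p (N+3)) = axis_offset x + (N+3) * trans_length x"
      using fp x ih l1 h gap_sym[of x "?p (N+3)"] gap_sym[of x "?p (N+2)"]
        gap_sym[of "?p (N+2)" "?p (N+3)"]
        gap_int_pow[OF x, of 1 "N+3"] gap_int_pow[OF x, of 1 "N+2"] gap_int_pow[OF x, of "N+2" "N+3"]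
      by (simp add: hyperbolic_def algebra_simps max_def split: if_splits)
    then show ?case using ih by (simp add: N_def algebra_simps)
  qed
  from this[of "nat (i - 1)"] show ?thesis using \<open>0 < i\<close> by simp
qed

lemma hyperbolic_inv: "x \<in> carrier G \<Longrightarrow> hyperbolic (inv x) \<longleftrightarrow> hyperbolic x"
  by (simp add: hyperbolic_def trans_length_inv)

lemma len_pow_le_elliptic:
  assumes x: "x \<in> carrier G" and h: "\<not> hyperbolic x"
  shows "len (x [^] (n::nat)) \<le> len x"
proof -
  have "len (x [^] n) \<le> len x \<and> len (x [^] Suc n) \<le> len x" for n
  proof (induction n)
    case 0
    show ?case using x len_nonneg by simp
  next
    case (Suc n)
    have "len (x [^] Suc (Suc n)) + len x \<le> len x + max (len (x [^] n)) (len (x [^] Suc n))"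
    proof -
      have s: "x [^] Suc n = x \<otimes> x [^] n" for n using x nat_pow_Suc2 by blast
      have g1: "gap x (x \<otimes> x) = len x" using x by (simp add: gap_def)
      have "gap \<one> (x [^] Suc (Suc n)) + gap x (x \<otimes> x)
        \<le> max (gap \<one> x + gap (x [^] Suc (Suc n)) (x \<otimes> x)) (gap \<one> (x \<otimes> x) + gap (x [^] Suc (Suc n)) x)"
        using x by (intro gap_four_point) auto
      moreover have "gap (x [^] Suc (Suc n)) (x \<otimes> x) = len (x [^] n)"
        using x gap_left[of "x \<otimes> x" "x [^] n" \<one>] s[of n] s[of "Suc n"] by (simp add: m_assoc)
      moreover have "gap (x [^] Suc (Suc n)) x = len (x [^] Suc n)"
        using x gap_left[of x "x [^] Suc n" \<one>] s[of "Suc n"] by simp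
      ultimately show ?thesis
        using x h g1 by (simp add: hyperbolic_def trans_length_def max_def split: if_splits)
    qed
    then show ?case using Suc by (simp add: max_def split: if_splits)
  qed
  then show ?thesis by blast
qed

text \<open>
  This description of hyperbolic elements is visibly invariant under conjugation and compatible
  with powers.
\<close>
lemma hyperbolic_iff_unbounded:
  assumes x: "x \<in> carrier G"
  shows "hyperbolic x \<longleftrightarrow> (\<forall>N. \<exists>n::nat. N < len (x [^] n))"
proof
  assume h: "hyperbolic x"
  show "\<forall>N. \<exists>n::nat. N < len (x [^] n)"
  proof
    fix N :: int
    let ?n = "nat (\<bar>N\<bar> + 1)"
    have "len (x [^] ?n) = axis_offset x + int ?n * trans_length x"
      using len_pow[OF x h, of "int ?n"] unfolding int_pow_int by simp
    moreover have "int ?n \<le> int ?n * trans_length x" using h by (simp add: hyperbolic_def)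
    moreover have "N < int ?n" by simp
    ultimately show "\<exists>n::nat. N < len (x [^] n)"
      using axis_offset_nonneg[OF x] by (intro exI[of _ ?n]) linarith
  qed
next
  assume "\<forall>N. \<exists>n::nat. N < len (x [^] n)"
  then show "hyperbolic x" using len_pow_le_elliptic[OF x] by (meson leD)
qed

lemma hyperbolic_conj:
  assumes "x \<in> carrier G" "g \<in> carrier G" "hyperbolic x"
  shows "hyperbolic (g \<otimes> x \<otimes> inv g)"
proof -
  have p: "(g \<otimes> x \<otimes> inv g) [^] n = g \<otimes> x [^] n \<otimes> inv g" for n :: nat
    using assms by (induction n) (simp_all add: m_assoc)
  show ?thesis
    unfolding hyperbolic_iff_unbounded[OF m_closed[OF m_closed[OF assms(2,1)] inv_closed[OF assms(2)]]]
  proof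
    fix N
    obtain n :: nat where n: "N + 2 * len g < len (x [^] n)"
      using assms hyperbolic_iff_unbounded by blast
    have "len (x [^] n) - len g \<le> len (g \<otimes> x [^] n)" "len (g \<otimes> x [^] n) - len g \<le> len (g \<otimes> x [^] n \<otimes> inv g)"
      using len_mult_ge[of g "x [^] n"] len_mult_ge[of "g \<otimes> x [^] n" "inv g"] assms by (simp_all add: len_inv)
    then show "\<exists>n::nat. N < len ((g \<otimes> x \<otimes> inv g) [^] n)"
      using n p by (intro exI[of _ n]) simp
  qed
qed

lemma hyperbolic_conj_iff:
  assumes "x \<in> carrier G" "g \<in> carrier G"
  shows "hyperbolic (g \<otimes> x \<otimes> inv g) \<longleftrightarrow> hyperbolic x"
  using hyperbolic_conj[of x g] hyperbolic_conj[of "g \<otimes> x \<otimes> inv g" "inv g"] assms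
  by (auto simp: group_rules)

lemma hyperbolic_pow:
  assumes x: "x \<in> carrier G" and h: "hyperbolic x" and k: "0 < k"
  shows "hyperbolic (x [^] (k::nat))"
proof -
  have "len (x [^] k) = axis_offset x + k * trans_length x" "len (x [^] (2 * k)) = axis_offset x + 2 * k * trans_length x"
    using len_pow[OF x h, of "int k"] len_pow[OF x h, of "int (2 * k)"] k unfolding int_pow_int by auto
  moreover have "x [^] k \<otimes> x [^] k = x [^] (2 * k)"
    using x by (simp add: nat_pow_mult mult_2)
  ultimately show ?thesis
    unfolding hyperbolic_def trans_length_def[of "x [^] k"] using k h by (simp add: hyperbolic_def)
qed

lemma elliptic_pow:
  assumes x: "x \<in> carrier G" and h: "\<not> hyperbolic x"
  shows "\<not> hyperbolic (x [^] (k::nat))"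
  using len_pow_le_elliptic[OF assms] hyperbolic_iff_unbounded[of "x [^] k"] x
  by (metis leD nat_pow_closed nat_pow_pow)

text \<open>
  If \<open>x\<close> does not move the base vertex along an axis, it turns the geodesic from the base vertex to
  its image around, so that the midpoint is fixed. For even length the midpoint is an orbit point
  \<open>z\<close>, and \<open>x\<close> is trivial since the action is free. For odd length \<open>z\<close> is the orbit point just
  before the midpoint.
\<close>
lemma elliptic_fixed_point:
  assumes x: "x \<in> carrier G" and h: "\<not> hyperbolic x"
  obtains z where "z \<in> carrier G" "len (inv z \<otimes> x \<otimes> z) \<le> len x mod 2"
proof -
  define k where "k = len x div 2"
  have k: "0 \<le> k" "k \<le> len x" using len_nonneg[OF x] by (auto simp: k_def)
  obtain z where z: "z \<in> carrier G" "len z = k" "len (inv z \<otimes> x) = len x - k"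
    using len_prefix[OF x k] by blast
  have xz: "x \<otimes> z \<in> carrier G" "x \<otimes> x \<in> carrier G" using x z by auto
  have g1: "gap z x = len x - k" using z by (simp add: gap_def)
  have g2: "gap x (x \<otimes> z) = k" "gap (x \<otimes> z) (x \<otimes> x) = len x - k" "gap x (x \<otimes> x) = len x"
    using gap_left[of x \<one> z] gap_left[of x z x] gap_left[of x \<one> x] x z g1 by auto
  have "gap \<one> (x \<otimes> z) \<le> max (len x - k) k"
    using gap_between[of x "x \<otimes> x" \<one> "x \<otimes> z"] g2 x z xz h
    by (simp add: hyperbolic_def trans_length_def)
  moreover have "gap (x \<otimes> z) z = max (len (x \<otimes> z) - k) (2 * k - len x)"
    using gap_between[of \<one> x "x \<otimes> z" z] g1 g2 x z xz gap_sym[of x "x \<otimes> z"] by simp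
  moreover have "gap (x \<otimes> z) z = len (inv z \<otimes> x \<otimes> z)"
    using gap_sym[of z "x \<otimes> z"] x z by (simp add: gap_def m_assoc)
  ultimately have "len (inv z \<otimes> x \<otimes> z) \<le> len x mod 2"
    using x xz k unfolding k_def by (simp add: max_def split: if_splits) presburger+
  with z that show thesis by blast
qed



text \<open>
  The hypotheses say that in the infinite path with steps \<open>s, t, s, t, \<dots>\<close> the two pieces of a
  step that are lost by backtracking at its ends do not exhaust the step. In a tree such a path
  does not close up, and it follows the axis of \<open>s t\<close> up to these pieces.
\<close>
lemma hyperbolic_mult:
  assumes s: "s \<in> carrier G" "t \<in> carrier G"
    and "2 * len s < len (s \<otimes> t) + len (t \<otimes> s)" "2 * len t < len (s \<otimes> t) + len (t \<otimes> s)"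
  shows "hyperbolic (s \<otimes> t)"
proof -
  let ?a = "s \<otimes> t" and ?b = "s \<otimes> t \<otimes> s" and ?c = "s \<otimes> t \<otimes> (s \<otimes> t)"
  have c: "?a \<in> carrier G" "?b \<in> carrier G" "?c \<in> carrier G" using s by auto
  have g: "gap s ?a = len t" "gap s ?b = len (t \<otimes> s)" "gap ?a ?b = len s"
    "gap ?a ?c = len (s \<otimes> t)" "gap ?b ?c = len t"
    using s by (simp_all add: gap_def group_rules)
  have sym: "gap ?a s = gap s ?a" "gap ?b s = gap s ?b" "gap ?b ?a = gap ?a ?b"
    "gap ?c ?a = gap ?a ?c" "gap ?c ?b = gap ?b ?c" "gap ?c s = gap s ?c"
    using c s gap_sym by blast+
  have "len ?b + len t = len (s \<otimes> t) + len (t \<otimes> s)"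
    using gap_four_point[of \<one> ?b s ?a] gap_four_point[of \<one> ?a s ?b] c s g sym assms(3,4)
    by (simp add: max_def split: if_splits)
  moreover have "len ?c + len s = len ?b + len (s \<otimes> t)"
    using gap_four_point[of \<one> ?c ?a ?b] gap_four_point[of \<one> ?b ?a ?c] c s g sym assms(3,4) calculation
    by (simp add: max_def split: if_splits)
  ultimately show ?thesis
    using assms(3,4) by (simp add: hyperbolic_def trans_length_def)
qed

section \<open>Words that are always hyperbolic\<close>

text \<open>
  On the geodesic from the base vertex to its image under \<open>e\<^sup>m\<close>, the points \<open>z\<close> admitted here lie
  on the axis of \<open>e\<close>, far enough from its end that \<open>e\<close> shifts them along the axis
  without leaving the geodesic.
\<close>
lemma between_shift:
  assumes e: "e \<in> carrier G" "hyperbolic e" and z: "z \<in> carrier G" and m: "0 < m"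
    and zm: "len z + gap z (e [^] (m::int)) = len (e [^] m)"
    and k: "axis_offset e \<le> 2 * len z" "2 * len z + 2 * trans_length e \<le> axis_offset e + 2 * m * trans_length e"
  shows "len (e \<otimes> z) = len z + trans_length e"
    and "len (e \<otimes> z) + gap (e \<otimes> z) (e [^] m) = len (e [^] m)"
proof -
  let ?k = "len z"
  have ez: "e \<otimes> z \<in> carrier G" using e z by auto
  have trans_length: "1 \<le> trans_length e" using e by (simp add: hyperbolic_def)
  have lm: "len (e [^] m) = axis_offset e + m * trans_length e" "len (e [^] (m + 1)) = axis_offset e + (m + 1) * trans_length e"
    "len e = axis_offset e + trans_length e"
    using len_pow[OF e m] len_pow[OF e, of "m+1"] m by (auto simp: axis_offset_def)
  have em: "e [^] (m + 1) = e \<otimes> e [^] m"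
    using e int_pow_mult[of e 1 m] by (simp add: add.commute)
  have g: "gap e (e \<otimes> z) = ?k" "gap (e \<otimes> z) (e [^] (m+1)) = axis_offset e + m * trans_length e - ?k"
    using gap_left[of e \<one> z] gap_left[of e z "e [^] m"] e z zm lm em by auto
  have ge: "gap e (e [^] (m+1)) = axis_offset e + m * trans_length e" "gap (e [^] m) (e [^] (m + 1)) = axis_offset e + trans_length e"
    using gap_int_pow[of e 1 "m+1"] gap_int_pow[of e m "m+1"] e lm by simp_all
  have l1: "len (e \<otimes> z) = ?k + trans_length e"
    using gap_between[of e "e [^] (m+1)" \<one> "e \<otimes> z"] e ez z g ge lm k
    by (simp add: algebra_simps)
  then show "len (e \<otimes> z) = len z + trans_length e" .
  have "gap \<one> (e \<otimes> z) + gap (e \<otimes> z) (e [^] (m+1)) = gap \<one> (e [^] (m+1))"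
    using l1 g lm e ez by (simp add: algebra_simps)
  then have "gap (e [^] m) (e \<otimes> z) =
      max (len (e [^] m) - len (e \<otimes> z)) (gap (e [^] m) (e [^] (m+1)) - gap (e \<otimes> z) (e [^] (m+1)))"
    using gap_between[of \<one> "e [^] (m+1)" "e [^] m" "e \<otimes> z"] e ez by simp
  then show "len (e \<otimes> z) + gap (e \<otimes> z) (e [^] m) = len (e [^] m)"
    using l1 ge g lm k gap_sym[of "e [^] m" "e \<otimes> z"] e ez by (simp add: algebra_simps)
qed

text \<open>
  The length of \<open>e\<^sup>m g e\<^sup>n\<close> is the distance of \<open>P = e\<^sup>-\<^sup>m\<close> and \<open>Q = g e\<^sup>n\<close>. If it is small, then the
  geodesics from \<open>1\<close> to \<open>P\<close> and from \<open>g\<close> to \<open>Q\<close>, which start at distance at most \<open>M\<close>, run together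
  for more than the translation length \<open>t\<close> of \<open>e\<close> while they follow the axis of \<open>e\<close> and its
  image under \<open>g\<close>. On this common segment \<open>e\<^sup>-\<^sup>1\<close> and \<open>g e g\<^sup>-\<^sup>1\<close> both are shifts by \<open>t\<close> in the
  same direction. So they agree at an orbit point, and are equal because the action is free.
\<close>
lemma len_turn_or_invert:
  assumes e: "e \<in> carrier G" "hyperbolic e" and g: "g \<in> carrier G" "len g \<le> M"
    and m: "2 * M + 3 \<le> m" and n: "2 * M + 3 \<le> n"
  shows "g \<otimes> e \<otimes> inv g = inv e \<or>
    axis_offset e + (m + n - 2) * trans_length e - 3 * M - 2 \<le> len (e [^] (m::int) \<otimes> g \<otimes> e [^] (n::int))"
proof (rule disjCI)
  assume "\<not> axis_offset e + (m + n - 2) * trans_length e - 3 * M - 2 \<le> len (e [^] m \<otimes> g \<otimes> e [^] n)"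
  then have short: "len (e [^] m \<otimes> g \<otimes> e [^] n) < axis_offset e + (m + n - 2) * trans_length e - 3 * M - 2"
    by simp
  define t where "t = trans_length e"
  define E where "E = axis_offset e"
  have t: "1 \<le> t" using e by (simp add: t_def hyperbolic_def)
  have E: "0 \<le> E" using axis_offset_nonneg e by (simp add: E_def)
  have M: "0 \<le> M" using g len_nonneg[of g] by simp
  have mt: "m \<le> m * t" "n \<le> n * t" using t m n M by simp_all
  have mnt: "(2 * M + 3) * t \<le> m * t" "(2 * M + 3) * t \<le> n * t" using t m n by simp_all
  have Mt: "M \<le> M * t" using t M by (simp add: mult_le_cancel_left1)
  define P where "P = inv e [^] m"
  define Q where "Q = g \<otimes> e [^] n"
  have ie: "inv e \<in> carrier G" "hyperbolic (inv e)" using e hyperbolic_inv by auto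
  have tie: "trans_length (inv e) = t" "axis_offset (inv e) = E" using e by (simp_all add: trans_length_inv axis_offset_inv t_def E_def)
  have PQ: "P \<in> carrier G" "Q \<in> carrier G" using e g by (auto simp: P_def Q_def)
  have lP: "len P = E + m * t" using len_pow[OF ie, of m] m M tie by (simp add: P_def)
  have len: "len (e [^] n) = E + n * t" using len_pow[OF e, of n] n M by (simp add: t_def E_def)
  have gQ: "gap g Q = E + n * t" using gap_left[of g \<one> "e [^] n"] g e len by (simp add: Q_def)
  have gPQ: "gap P Q = len (e [^] m \<otimes> g \<otimes> e [^] n)"
    using e g by (simp add: gap_def P_def Q_def int_pow_inv group_rules)
  have short: "gap P Q < E + (m + n - 2) * t - 3 * M - 2"
    using short gPQ by (simp add: E_def t_def)
  have lQ: "E + n * t - M \<le> len Q" using len_mult_ge(2)[of g "e [^] n"] e g len by (simp add: Q_def)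
  have lgP: "E + m * t - M \<le> gap g P"
    using gap_triangle[of \<one> g P] g PQ lP by simp
  \<comment> \<open>beyond the distance \<open>E / 2\<close> the geodesic follows the axis of \<open>e\<close>, and \<open>M\<close> steps later it is
    also past the point where the geodesic from \<open>g\<close> joins it\<close>
  define k where "k = (E + 1) div 2 + M"
  have k: "E + 2 * M \<le> 2 * k" "2 * k \<le> E + 1 + 2 * M" by (auto simp: k_def)
  have k0: "0 \<le> k" "k \<le> len P" using k E M lP mt(1) m by linarith+
  obtain z where z: "z \<in> carrier G" "len z = k" "len (inv z \<otimes> P) = len P - k"
    using len_prefix[OF PQ(1) k0] by blast
  have zP: "gap z P = len P - k" using z by (simp add: gap_def)
  have sym: "gap g Q = gap Q g" "gap g P = gap P g" "gap P Q = gap Q P"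
    using gap_sym g PQ by blast+
  have sum: "gap g P + len Q \<le> E + m * t + (E + n * t)"
    using gap_four_point[of g P Q \<one>] g PQ lP gQ short sym mt m t M E
    by (simp add: algebra_simps max_def split: if_splits)
  have overlap: "gap g y + gap y Q = gap g Q" "gap g y = gap g P - len P + len y"
    if y: "y \<in> carrier G" "len y + gap y P = len P" "k \<le> len y" "len y \<le> k + t" for y
  proof -
    have "gap g y = max (len g - len y) (gap g P - gap y P)"
      using gap_between[of \<one> P g y] y PQ g by simp
    then show 1: "gap g y = gap g P - len P + len y"
      using y k g lP lgP M E by simp
    have "gap Q y = max (len Q - len y) (gap Q P - gap y P)"
      using gap_between[of \<one> P Q y] y PQ by simp
    then have "gap Q y = len Q - len y"
      using y k lP lQ short sym by (simp add: algebra_simps)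
    then show "gap g y + gap y Q = gap g Q"
      using 1 sum lP gQ gap_triangle[of g y Q] g PQ y gap_sym[of Q y] by simp
  qed
  have sh1: "len (inv e \<otimes> z) = k + t" "len (inv e \<otimes> z) + gap (inv e \<otimes> z) P = len P"
    using between_shift[OF ie z(1), of m] m M z zP tie k mt mnt Mt lP t E
    unfolding P_def[symmetric] by (simp_all add: algebra_simps)
  have iz: "inv e \<otimes> z \<in> carrier G" using e z by auto
  note o1 = overlap[of z] and o2 = overlap[OF iz]
  define k' where "k' = gap g z"
  have k': "k' = gap g P - len P + k" using o1 z zP t by (simp add: k'_def)
  have k'b: "k - M \<le> k'" "k' \<le> k + M"
    using k' lgP lP gap_triangle[of g \<one> P] g PQ by auto
  define w where "w = inv g \<otimes> z"
  have w: "w \<in> carrier G" "len w = k'" using g z by (auto simp: w_def k'_def gap_def)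
  have wn: "len w + gap w (e [^] n) = len (e [^] n)"
  proof -
    have "gap w (e [^] n) = gap z Q"
      using gap_left[of g w "e [^] n"] g e z w by (simp add: w_def Q_def)
    then show ?thesis using o1 z zP t w k'_def gQ len by simp
  qed
  have sh2: "len (e \<otimes> w) = k' + t" "len (e \<otimes> w) + gap (e \<otimes> w) (e [^] n) = len (e [^] n)"
    using between_shift[OF e w(1), of n] n M w wn k k'b mt mnt Mt t E
    unfolding t_def[symmetric] E_def[symmetric] by (simp_all add: algebra_simps)
  have gew: "g \<otimes> (e \<otimes> w) \<in> carrier G" using e g w by auto
  have "gap g (g \<otimes> (e \<otimes> w)) = k' + t" "gap (g \<otimes> (e \<otimes> w)) Q = gap (e \<otimes> w) (e [^] n)"
    using gap_left[of g \<one> "e \<otimes> w"] gap_left[of g "e \<otimes> w" "e [^] n"] sh2 g e w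
    by (simp_all add: Q_def)
  then have "g \<otimes> (e \<otimes> w) = inv e \<otimes> z"
    using between_unique[OF g(1) PQ(2) gew iz] o2 sh1 sh2 k' gQ len t by simp
  then have "g \<otimes> e \<otimes> inv g \<otimes> z = inv e \<otimes> z"
    using g e z by (simp add: w_def m_assoc)
  then show "g \<otimes> e \<otimes> inv g = inv e"
    using g e z right_cancel[of z "g \<otimes> e \<otimes> inv g" "inv e"] by simp
qed

text \<open>
  The powers of \<open>e\<close> are long compared with \<open>g\<close> and \<open>h\<close>, and by the previous lemma little of them
  is lost at the turns that \<open>g\<close> and \<open>h\<close> make between them.
\<close>
lemma two_turns_hyperbolic:
  fixes m n :: int
  assumes e: "e \<in> carrier G" "hyperbolic e"
    and g: "g \<in> carrier G" "len g \<le> M" "g \<otimes> e \<otimes> inv g \<noteq> inv e"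
    and h: "h \<in> carrier G" "len h \<le> M" "h \<otimes> e \<otimes> inv h \<noteq> inv e"
    and m: "5 * M + 5 \<le> m" and n: "5 * M + 5 \<le> n"
  shows "hyperbolic (g \<otimes> e [^] m \<otimes> (h \<otimes> e [^] n))"
    and "axis_offset e + (m + n - 2) * trans_length e - 4 * M - 2 \<le> len (g \<otimes> e [^] m \<otimes> (h \<otimes> e [^] n))"
proof -
  let ?s = "g \<otimes> e [^] m" and ?t = "h \<otimes> e [^] n"
  have st: "?s \<in> carrier G" "?t \<in> carrier G" using e g h by auto
  have M: "0 \<le> M" using g len_nonneg[of g] by simp
  have t: "1 \<le> trans_length e" using e by (simp add: hyperbolic_def)
  have E: "0 \<le> axis_offset e" using axis_offset_nonneg e by simp
  have "len (e [^] m \<otimes> h \<otimes> e [^] n) - len g \<le> len (?s \<otimes> ?t)"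
    using len_mult_ge(2)[of g "e [^] m \<otimes> h \<otimes> e [^] n"] e g h by (simp add: m_assoc)
  moreover have "axis_offset e + (m + n - 2) * trans_length e - 3 * M - 2 \<le> len (e [^] m \<otimes> h \<otimes> e [^] n)"
    using len_turn_or_invert[OF e h(1,2), of m n] h m n M by simp
  ultimately show st_len: "axis_offset e + (m + n - 2) * trans_length e - 4 * M - 2 \<le> len (?s \<otimes> ?t)"
    using g by simp
  have "len (e [^] n \<otimes> g \<otimes> e [^] m) - len h \<le> len (?t \<otimes> ?s)"
    using len_mult_ge(2)[of h "e [^] n \<otimes> g \<otimes> e [^] m"] e g h by (simp add: m_assoc)
  moreover have "axis_offset e + (n + m - 2) * trans_length e - 3 * M - 2 \<le> len (e [^] n \<otimes> g \<otimes> e [^] m)"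
    using len_turn_or_invert[OF e g(1,2), of n m] g m n M by simp
  ultimately have ts_len: "axis_offset e + (m + n - 2) * trans_length e - 4 * M - 2 \<le> len (?t \<otimes> ?s)"
    using h by (simp add: add.commute)
  have "len ?s \<le> M + axis_offset e + m * trans_length e" "len ?t \<le> M + axis_offset e + n * trans_length e"
    using len_mult[of g "e [^] m"] len_mult[of h "e [^] n"] len_pow[OF e, of m] len_pow[OF e, of n]
      e g h m n M by simp_all
  moreover have "5 * M + 3 \<le> (m - 2) * trans_length e" "5 * M + 3 \<le> (n - 2) * trans_length e"
  proof -
    have "m - 2 \<le> (m - 2) * trans_length e" "n - 2 \<le> (n - 2) * trans_length e" using t m n M by simp_all
    with m n show "5 * M + 3 \<le> (m - 2) * trans_length e" "5 * M + 3 \<le> (n - 2) * trans_length e" by linarith+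
  qed
  ultimately show "hyperbolic (?s \<otimes> ?t)"
    using st_len ts_len st by (intro hyperbolic_mult) (simp_all add: algebra_simps)
qed

text \<open>
  If \<open>g\<close> inverts \<open>e\<close>, then \<open>g e\<^sup>n\<close> has the same square as \<open>g\<close> for all \<open>n\<close>. For large \<open>n\<close> it is longer
  than its square, hence elliptic, whereas its square is hyperbolic with \<open>g\<close>.
\<close>
lemma hyperbolic_not_invert:
  assumes e: "e \<in> carrier G" "hyperbolic e" and g: "g \<in> carrier G" "hyperbolic g"
  shows "g \<otimes> e \<otimes> inv g \<noteq> inv e"
proof
  assume inv: "g \<otimes> e \<otimes> inv g = inv e"
  obtain n :: nat where n: "len (g \<otimes> g) + len g < len (e [^] n)"
    using hyperbolic_iff_unbounded e by blast
  let ?x = "g \<otimes> e [^] n"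
  have x: "?x \<in> carrier G" using e g by auto
  have eg: "e \<otimes> (g \<otimes> e) = g"
  proof -
    have "g \<otimes> e = inv e \<otimes> g" using inv e g by (metis inv_closed inv_solve_right m_closed)
    then show ?thesis using e g by simp
  qed
  have "e [^] k \<otimes> (g \<otimes> e [^] k) = g" for k :: nat
  proof (induction k)
    case (Suc k)
    have "e [^] Suc k \<otimes> (g \<otimes> e [^] Suc k) = (e [^] k \<otimes> e) \<otimes> (g \<otimes> (e \<otimes> e [^] k))"
      using nat_pow_Suc2[OF e(1), of k] by (metis nat_pow_Suc)
    also have "\<dots> = e [^] k \<otimes> (e \<otimes> (g \<otimes> e)) \<otimes> e [^] k"
      using e g by (simp add: m_assoc)
    finally show ?case using eg Suc e g by (simp add: m_assoc)
  qed (use g in auto)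
  then have xx: "?x \<otimes> ?x = g \<otimes> g" using e g by (simp add: m_assoc)
  moreover have "len (g \<otimes> g) < len ?x"
    using len_mult_ge(2)[of g "e [^] n"] n e g by simp
  ultimately have "\<not> hyperbolic ?x" by (simp add: hyperbolic_def trans_length_def)
  moreover have "hyperbolic (?x [^] (2::nat))"
    using hyperbolic_pow[OF g, of 2] xx x g by (simp add: numeral_2_eq_2 m_assoc)
  ultimately show False using elliptic_pow x by blast
qed

text \<open>
  The exponents have two purposes. Both are at least \<open>10\<close>, which is the bound \<open>5 M + 5\<close> of
  \<open>two_turns_hyperbolic\<close> for \<open>M = 1\<close>. They are different, so that a power of \<open>c\<close> remains if \<open>h\<^sup>r\<close> inverts \<open>c\<close>.
\<close>
definition test_word :: "'a \<Rightarrow> nat \<Rightarrow> 'a \<Rightarrow> 'a" where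
  "test_word c r h = c [^] (20::nat) \<otimes> h [^] r \<otimes> (c [^] (10::nat) \<otimes> h [^] r)"

lemma test_word_closed [simp]: "\<lbrakk>c \<in> carrier G; h \<in> carrier G\<rbrakk> \<Longrightarrow> test_word c r h \<in> carrier G"
  by (simp add: test_word_def)

text \<open>
  After a conjugation the elliptic element \<open>h\<^sup>r\<close> becomes an element \<open>a\<close> of length at most \<open>1\<close>, and \<open>c\<close>
  some hyperbolic \<open>e\<close>. If \<open>a\<close> does not invert \<open>e\<close>, the long powers of \<open>e\<close> meet two short turns. If
  it does, the word collapses to \<open>e\<^sup>-\<^sup>1\<^sup>0 a a\<close> with commuting factors \<open>e\<^sup>-\<^sup>1\<^sup>0\<close> and \<open>a a\<close>, whose powers
  are unbounded because those of \<open>a\<close> are bounded.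
\<close>
lemma test_word_elliptic:
  assumes c: "c \<in> carrier G" "hyperbolic c" and h: "h \<in> carrier G" "\<not> hyperbolic h"
  shows "hyperbolic (test_word c r h)"
proof -
  have hr: "h [^] r \<in> carrier G" "\<not> hyperbolic (h [^] r)" using h elliptic_pow by auto
  obtain z where z: "z \<in> carrier G" "len (inv z \<otimes> h [^] r \<otimes> z) \<le> len (h [^] r) mod 2"
    using elliptic_fixed_point[OF hr] by blast
  define e where "e = inv z \<otimes> c \<otimes> z"
  define a where "a = inv z \<otimes> h [^] r \<otimes> z"
  have e: "e \<in> carrier G" "hyperbolic e"
    using c z hyperbolic_conj[of c "inv z"] by (auto simp: e_def)
  have a: "a \<in> carrier G" "\<not> hyperbolic a" "len a \<le> 1"
  proof -
    show "a \<in> carrier G" using h z by (auto simp: a_def)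
    show "\<not> hyperbolic a" using hr z hyperbolic_conj_iff[of "h [^] r" "inv z"] by (simp add: a_def)
    show "len a \<le> 1" using z(2) pos_mod_bound[of 2 "len (h [^] r)"] unfolding a_def by linarith
  qed
  have ep: "e [^] k = inv z \<otimes> c [^] k \<otimes> z" for k :: nat
    using c z by (induction k) (simp_all add: e_def m_assoc)
  have w: "test_word c r h = (z \<otimes> inv a) \<otimes> (a \<otimes> e [^] (20::nat) \<otimes> (a \<otimes> e [^] (10::nat))) \<otimes> inv (z \<otimes> inv a)"
    unfolding test_word_def ep using c h z by (simp add: a_def group_rules)
  have "hyperbolic (a \<otimes> e [^] (20::nat) \<otimes> (a \<otimes> e [^] (10::nat)))"
  proof (cases "a \<otimes> e \<otimes> inv a = inv e")
    case False
    then show ?thesis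
      using two_turns_hyperbolic(1)[OF e a(1,3) False a(1,3) False, of "int 20" "int 10"]
      unfolding int_pow_int by simp
  next
    case True
    have ae: "a \<otimes> e [^] k = inv e [^] k \<otimes> a" for k :: nat
    proof (induction k)
      case (Suc k)
      have 1: "a \<otimes> e = inv e \<otimes> a" using True a e by (metis inv_closed inv_solve_right m_closed)
      have "a \<otimes> e [^] Suc k = (a \<otimes> e [^] k) \<otimes> e" using a e by (simp add: m_assoc)
      also have "\<dots> = inv e [^] k \<otimes> (a \<otimes> e)" using Suc a e by (simp add: m_assoc)
      also have "\<dots> = inv e [^] Suc k \<otimes> a" using 1 a e by (simp add: m_assoc)
      finally show ?case .
    qed (use a in auto)
    let ?q = "inv e [^] (10::nat)"
    have q: "?q \<in> carrier G" "hyperbolic ?q"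
      using e hyperbolic_inv[of e] hyperbolic_pow[of "inv e" 10] by auto
    have e10: "e [^] (10::nat) = inv ?q" using e by (simp add: nat_pow_inv)
    have e20: "e [^] (20::nat) = inv ?q \<otimes> inv ?q"
      using e by (simp add: nat_pow_mult flip: e10)
    have aq: "a \<otimes> inv ?q = ?q \<otimes> a" using ae[of 10] e10 by simp
    have qa: "a \<otimes> ?q = inv ?q \<otimes> a"
      using aq a(1) q(1) by (metis inv_closed inv_solve_left inv_solve_right m_assoc m_closed)
    have x: "a \<otimes> e [^] (20::nat) \<otimes> (a \<otimes> e [^] (10::nat)) = ?q \<otimes> (a \<otimes> a)"
      (is "?x = _")
    proof -
      have "?x = a \<otimes> inv ?q \<otimes> inv ?q \<otimes> (a \<otimes> inv ?q)" using e20 e10 a q by (simp add: m_assoc)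
      also have "\<dots> = ?q \<otimes> a \<otimes> inv ?q \<otimes> (?q \<otimes> a)" unfolding aq ..
      also have "\<dots> = ?q \<otimes> (a \<otimes> inv ?q) \<otimes> (?q \<otimes> a)" using a(1) q(1) by (simp add: m_assoc)
      also have "\<dots> = ?q \<otimes> (?q \<otimes> a) \<otimes> (?q \<otimes> a)" unfolding aq ..
      also have "\<dots> = ?q \<otimes> ?q \<otimes> (a \<otimes> ?q) \<otimes> a" using a q by (simp add: m_assoc)
      also have "\<dots> = ?q \<otimes> ?q \<otimes> (inv ?q \<otimes> a) \<otimes> a" unfolding qa ..
      also have "\<dots> = ?q \<otimes> (a \<otimes> a)" using a q(1) by (simp add: m_assoc del: nat_pow_inv)
      finally show ?thesis .
    qed
    have comm: "?q \<otimes> (a \<otimes> a) = (a \<otimes> a) \<otimes> ?q"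
    proof -
      have "(a \<otimes> a) \<otimes> ?q = a \<otimes> (a \<otimes> ?q)" using a(1) q(1) by (simp add: m_assoc)
      also have "\<dots> = (a \<otimes> inv ?q) \<otimes> a" unfolding qa using a(1) q(1) by (simp add: m_assoc del: nat_pow_inv)
      also have "\<dots> = ?q \<otimes> (a \<otimes> a)" unfolding aq using a(1) q(1) by (simp add: m_assoc)
      finally show ?thesis ..
    qed
    have p: "(?q \<otimes> (a \<otimes> a)) [^] k = ?q [^] k \<otimes> a [^] (2 * k)" for k :: nat
    proof -
      have "(?q \<otimes> (a \<otimes> a)) [^] k = ?q [^] k \<otimes> (a \<otimes> a) [^] k"
        using pow_mult_distrib[OF comm] a q by auto
      also have "(a \<otimes> a) [^] k = (a [^] (2::nat)) [^] k" using a by (simp add: numeral_2_eq_2)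
      finally show ?thesis using a by (simp add: nat_pow_pow)
    qed
    have "\<exists>k::nat. N < len ((?q \<otimes> (a \<otimes> a)) [^] k)" for N
    proof -
      obtain k :: nat where k: "N + 1 < len (?q [^] k)" using q hyperbolic_iff_unbounded by blast
      have "len (?q [^] k) - len (a [^] (2 * k)) \<le> len ((?q \<otimes> (a \<otimes> a)) [^] k)"
        using len_mult_ge(1)[of "?q [^] k" "a [^] (2 * k)"] p a q by simp
      moreover have "len (a [^] (2 * k)) \<le> 1" using len_pow_le_elliptic[OF a(1,2)] a(3) by (meson order_trans)
      ultimately show ?thesis using k by (intro exI[of _ k]) simp
    qed
    then show ?thesis
      unfolding x using hyperbolic_iff_unbounded[of "?q \<otimes> (a \<otimes> a)"] a q by auto
  qed
  then show ?thesis
    unfolding w using a z e by (intro hyperbolic_conj) auto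
qed

text \<open>
  For hyperbolic \<open>h\<close> the roles are exchanged: the long powers are those of \<open>h\<close>, and \<open>c\<^sup>2\<^sup>0\<close> and \<open>c\<^sup>1\<^sup>0\<close>
  are the turns. Therefore \<open>C\<close> depends on \<open>c\<close> alone.
\<close>
lemma test_word_growth:
  assumes c: "c \<in> carrier G" "hyperbolic c"
  obtains C :: nat where "\<And>r h. \<lbrakk>C \<le> r; h \<in> carrier G\<rbrakk> \<Longrightarrow> hyperbolic (test_word c r h)"
    and "\<And>r h. \<lbrakk>C \<le> r; h \<in> carrier G; hyperbolic h\<rbrakk> \<Longrightarrow>
      max (len h) (int r) \<le> len (test_word c r h) + int C"
proof -
  let ?g = "c [^] (20::nat)" and ?h = "c [^] (10::nat)"
  have gh: "?g \<in> carrier G" "?h \<in> carrier G" "hyperbolic ?g" "hyperbolic ?h"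
    using c hyperbolic_pow by auto
  define M where "M = max (len ?g) (len ?h)"
  have M: "0 \<le> M" "len ?g \<le> M" "len ?h \<le> M"
    using len_nonneg gh by (auto simp: M_def le_max_iff_disj)
  define C where "C = nat (5 * M + 5)"
  have C: "int C = 5 * M + 5" using M by (simp add: C_def)
  have *: "hyperbolic (test_word c r h)" "max (len h) (int r) \<le> len (test_word c r h) + int C"
    if r: "C \<le> r" and h: "h \<in> carrier G" "hyperbolic h" for r h
  proof -
    have rM: "5 * M + 5 \<le> int r" using r C by simp
    note tt = two_turns_hyperbolic[OF h gh(1) M(2) hyperbolic_not_invert[OF h gh(1,3)]
       gh(2) M(3) hyperbolic_not_invert[OF h gh(2,4)] rM rM, unfolded int_pow_int]
    show "hyperbolic (test_word c r h)" using tt(1) by (simp add: test_word_def)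
    have t: "1 \<le> trans_length h" using h by (simp add: hyperbolic_def)
    have E: "0 \<le> axis_offset h" using axis_offset_nonneg h by simp
    define D where "D = (int r + int r - 2) * trans_length h"
    have "len h = axis_offset h + trans_length h" by (simp add: axis_offset_def)
    moreover have "axis_offset h + D - 4 * M - 2 \<le> len (test_word c r h)"
      using tt(2) by (simp add: test_word_def D_def)
    moreover have "1 * trans_length h \<le> D"
      unfolding D_def using t rM M by (intro mult_right_mono) auto
    moreover have "(int r + int r - 2) * 1 \<le> D"
      unfolding D_def using t rM M by (intro mult_left_mono) auto
    then have "2 * int r - 2 \<le> D" by simp
    ultimately have "len h \<le> len (test_word c r h) + int C" "int r \<le> len (test_word c r h) + int C"
      using rM C E M by linarith+
    then show "max (len h) (int r) \<le> len (test_word c r h) + int C" by simp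
  qed
  show thesis
    by (rule that[of C]) (use * test_word_elliptic[OF c] in blast)+
qed

text \<open>
  After a conjugation this says that nontrivial elliptic elements with elliptic product have a
  common fixed vertex. If \<open>b\<close> is longer than \<open>1\<close>, then the geodesics to \<open>b\<close> and to \<open>b\<^sup>-\<^sup>1\<close>
  start with the same half of \<open>b\<close>, and those to \<open>a b\<close> and its inverse with the same half of \<open>a b\<close>, because
  \<open>b\<close> and \<open>a b\<close> are elliptic. As \<open>b\<^sup>-\<^sup>1 a\<^sup>-\<^sup>1\<close> starts like \<open>b\<^sup>-\<^sup>1\<close>, the geodesics to \<open>b\<close> and \<open>a b\<close>
  run together for at least the distance \<open>1\<close>, which the axiom on elements of length \<open>1\<close> excludes.
  Here the length of \<open>b\<close> is at least \<open>3\<close>, since the midpoint argument makes elliptic elements of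
  even length trivial.
\<close>
lemma elliptic_common_fixed_point:
  assumes a: "a \<in> carrier G" "len a = 1" and b: "b \<in> carrier G" "\<not> hyperbolic b"
    and ab: "\<not> hyperbolic (a \<otimes> b)"
  shows "len b \<le> 1"
proof (rule ccontr)
  assume "\<not> len b \<le> 1"
  then have b2: "2 \<le> len b" by simp
  have "len b \<noteq> 2"
  proof
    assume 2: "len b = 2"
    obtain z where z: "z \<in> carrier G" "len (inv z \<otimes> b \<otimes> z) \<le> len b mod 2"
      using elliptic_fixed_point[OF b] by blast
    then have "len (inv z \<otimes> b \<otimes> z) = 0" using 2 len_nonneg[of "inv z \<otimes> b \<otimes> z"] b by simp
    then have "inv z \<otimes> b \<otimes> z = \<one>" using len_eq_0_iff[of "inv z \<otimes> b \<otimes> z"] z b by simp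
    then have "b = \<one>" using z b
      by (metis inv_closed inv_equality inv_inv l_cancel_one m_assoc m_closed r_inv)
    then show False using 2 by simp
  qed
  with b2 have b3: "3 \<le> len b" by simp
  let ?x = "a \<otimes> b"
  have x: "?x \<in> carrier G" using a b by auto
  have lx: "len b - 1 \<le> len ?x" using len_mult_ge(2)[of a b] a b by simp
  have u1: "min (len b + len b - len (b \<otimes> b)) (len b + len ?x - 1) \<le> len b + len ?x - len (inv b \<otimes> inv ?x)"
    using len_ultrametric[of b "inv b" "inv ?x"] a b len_inv[of b] len_inv[of ?x] len_inv[of "b \<otimes> b"] len_inv[of a]
    by (simp add: group_rules)
  have u2: "min (len b + len ?x - len (inv b \<otimes> inv ?x)) (len ?x + len ?x - len (?x \<otimes> ?x))
      \<le> len b + len ?x - len (inv b \<otimes> ?x)"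
    using len_ultrametric[of b "inv ?x" ?x] a b len_inv[of ?x] by simp
  have "len ?x + len b - 1 \<le> len (inv b \<otimes> ?x)" using len_syllable[of a b] a b by simp
  then show False
    using u1 u2 lx b3 b(2) ab by (simp add: hyperbolic_def trans_length_def min_def split: if_splits)
qed

end

section \<open>The syllable length on a free product\<close>

text \<open>
  Twice the distance along which the geodesics to two reduced words run together in the
  Bass-Serre tree. If the words part in different elements of the same factor, the geodesics still
  share the edge of length \<open>1/2\<close> that leads to the vertex of this factor.
\<close>
fun overlap :: "('i \<times> 'a) list \<Rightarrow> ('i \<times> 'a) list \<Rightarrow> nat" where
  "overlap ((i, x) # u) ((j, y) # v) =
     (if i \<noteq> j then 0 else if x \<noteq> y then 1 else Suc (Suc (overlap u v)))"
| "overlap _ _ = 0"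

lemma overlap_ultrametric: "min (overlap u v) (overlap v w) \<le> overlap u w"
proof (induction u v arbitrary: w rule: overlap.induct)
  case (1 i x u j y v)
  show ?case
  proof (cases w)
    case (Cons s w')
    then show ?thesis using 1[of w'] by (cases s) auto
  qed simp
qed auto

context group_family begin

text \<open>
  With \<open>v = u w\<close> this computes the length of \<open>u\<^sup>-\<^sup>1 v\<close> from those of \<open>u\<close> and \<open>v\<close> and their overlap,
  in a form that needs no description of inverses by reduced words.
\<close>
lemma length_syllable_mult_overlap:
  assumes "u \<in> reduced_words I G" "w \<in> reduced_words I G"
  shows "length w + overlap u (foldr (syllable_mult G) u w) =
    length u + length (foldr (syllable_mult G) u w)"
  using assms(1)
proof (induction u)
  case (Cons s u)
  obtain i x where s: "s = (i, x)" by (cases s)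
  with Cons.prems have x: "i \<in> I" "x \<in> carrier (G i)" "x \<noteq> \<one>\<^bsub>G i\<^esub>" and u: "u \<in> reduced_words I G"
    and hd: "u = [] \<or> fst (hd u) \<noteq> i"
    by (auto simp: Cons_reduced_words_iff)
  interpret group "G i" using group_factor x by blast
  let ?v = "foldr (syllable_mult G) u w"
  have v: "?v \<in> reduced_words I G" using foldr_syllable_mult_closed u assms by blast
  have IH: "length w + overlap u ?v = length u + length ?v" using Cons.IH u by blast
  show ?case
  proof (cases ?v)
    case Nil
    then show ?thesis using IH s x by simp
  next
    case (Cons t v')
    then obtain j y where v': "?v = (j, y) # v'" by (cases t) auto
    show ?thesis
    proof (cases "i = j")
      case True
      have y: "y \<in> carrier (G i)" "y \<noteq> \<one>\<^bsub>G i\<^esub>" and hd': "v' = [] \<or> fst (hd v') \<noteq> i"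
        using v v' True by (auto simp: Cons_reduced_words_iff)
      have "overlap u ?v = 0" using hd v' True by (cases u) auto
      moreover have "overlap ((i, x) # u) v' = 0" using hd' by (cases v') auto
      moreover have "x \<otimes>\<^bsub>G i\<^esub> y \<noteq> x" using x y by simp
      ultimately show ?thesis using IH s x v' True by simp
    qed (use IH s x v' in simp)
  qed
qed simp

lemma foldr_syllable_mult_append:
  "u @ v \<in> reduced_words I G \<Longrightarrow> foldr (syllable_mult G) u v = u @ v"
proof (induction u)
  case (Cons s u)
  then show ?case
    using syllable_mult_Cons[of "fst s" "snd s" "u @ v" I G]
    by (cases s) (auto simp: Cons_reduced_words_iff)
qed simp

lemma reduced_words_appendD:
  assumes "u @ v \<in> reduced_words I G" shows "u \<in> reduced_words I G" "v \<in> reduced_words I G"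
  using assms by (auto simp: reduced_words_def distinct_adj_append_iff)

lemma overlap_syllable:
  assumes "[(i, x)] \<in> reduced_words I G" "v \<in> reduced_words I G"
  shows "overlap v (syllable_mult G (i, x) v) \<le> 1"
proof (cases v)
  case (Cons t v')
  obtain j y where v: "v = (j, y) # v'" using Cons by (cases t) auto
  have x: "i \<in> I" "x \<in> carrier (G i)" "x \<noteq> \<one>\<^bsub>G i\<^esub>" using assms by (auto simp: Cons_reduced_words_iff)
  interpret group "G i" using group_factor x by blast
  show ?thesis
  proof (cases "i = j")
    case True
    have y: "y \<in> carrier (G i)" "v' = [] \<or> fst (hd v') \<noteq> i"
      using assms v True by (auto simp: Cons_reduced_words_iff)
    then have "overlap v v' = 0" using v True by (cases v') auto
    moreover have "x \<otimes>\<^bsub>G i\<^esub> y \<noteq> y" using x y by simp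
    ultimately show ?thesis using v x True by auto
  qed (use v x in auto)
qed simp

theorem tree_length_free_product:
  "tree_length_group (free_product I G) (\<lambda>w. int (length w))"
proof -
  let ?F = "free_product I G"
  interpret F: group ?F by (rule group_free_product)
  have gap: "int (length (inv\<^bsub>?F\<^esub> u \<otimes>\<^bsub>?F\<^esub> v)) = int (length u) + int (length v) - int (overlap u v)"
    if "u \<in> carrier ?F" "v \<in> carrier ?F" for u v
  proof -
    have "inv\<^bsub>?F\<^esub> u \<otimes>\<^bsub>?F\<^esub> v \<in> carrier ?F" using that by blast
    moreover have "u \<otimes>\<^bsub>?F\<^esub> (inv\<^bsub>?F\<^esub> u \<otimes>\<^bsub>?F\<^esub> v) = v"
      using that F.m_assoc[of u "inv\<^bsub>?F\<^esub> u" v] F.r_inv[of u] F.l_one[of v] F.inv_closed[of u] by metis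
    ultimately show ?thesis
      using length_syllable_mult_overlap[of u "inv\<^bsub>?F\<^esub> u \<otimes>\<^bsub>?F\<^esub> v"] that by simp
  qed
  show ?thesis
  proof
    fix x y z assume *: "x \<in> carrier ?F" "y \<in> carrier ?F" "z \<in> carrier ?F"
    show "min (int (length x) + int (length y) - int (length (inv\<^bsub>?F\<^esub> x \<otimes>\<^bsub>?F\<^esub> y)))
        (int (length y) + int (length z) - int (length (inv\<^bsub>?F\<^esub> y \<otimes>\<^bsub>?F\<^esub> z)))
       \<le> int (length x) + int (length z) - int (length (inv\<^bsub>?F\<^esub> x \<otimes>\<^bsub>?F\<^esub> z))"
      using overlap_ultrametric[of x y z] unfolding gap[OF *(1,2)] gap[OF *(2,3)] gap[OF *(1,3)] by simp
  next
    fix x k assume x: "x \<in> carrier ?F" and k: "0 \<le> k" "k \<le> int (length x)"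
    let ?u = "take (nat k) x" and ?v = "drop (nat k) x"
    have "?u @ ?v \<in> reduced_words I G" using x by simp
    then have uv: "?u \<in> carrier ?F" "?v \<in> carrier ?F" "?u \<otimes>\<^bsub>?F\<^esub> ?v = x"
      using reduced_words_appendD[of ?u ?v] foldr_syllable_mult_append[of ?u ?v] by simp_all
    then have "inv\<^bsub>?F\<^esub> ?u \<otimes>\<^bsub>?F\<^esub> x = ?v"
      using F.inv_solve_left x by metis
    then show "\<exists>z \<in> carrier ?F. int (length z) = k \<and> int (length (inv\<^bsub>?F\<^esub> z \<otimes>\<^bsub>?F\<^esub> x)) = int (length x) - k"
      using uv k by (intro bexI[of _ ?u]) auto
  next
    fix x y assume x: "x \<in> carrier ?F" and y: "y \<in> carrier ?F" and l: "int (length x) = 1"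
    have "length x = 1" using l by simp
    then obtain i a where ia: "x = [(i, a)]" by (cases x) auto
    have "x \<otimes>\<^bsub>?F\<^esub> y \<in> carrier ?F" using x y by blast
    from gap[OF y this] overlap_syllable[of i a y] x y ia
    show "int (length (x \<otimes>\<^bsub>?F\<^esub> y)) + int (length y) - 1 \<le> int (length (inv\<^bsub>?F\<^esub> y \<otimes>\<^bsub>?F\<^esub> (x \<otimes>\<^bsub>?F\<^esub> y)))"
      by simp
  next
    fix x assume "x \<in> carrier ?F"
    with gap[of x "\<one>\<^bsub>?F\<^esub>"] F.r_one[of "inv\<^bsub>?F\<^esub> x"] F.one_closed F.inv_closed[of x]
    show "int (length (inv\<^bsub>?F\<^esub> x)) = int (length x)"
      by (cases x) auto
  qed simp
qed

text \<open>Syllables from different factors would have a product of length two.\<close>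
lemma short_subgroup_in_factor:
  assumes B: "subgroup B (free_product I G)" and short: "\<And>b. b \<in> B \<Longrightarrow> length b \<le> 1"
    and nontrivial: "B \<noteq> {[]}"
  shows "\<exists>i \<in> I. \<exists>H. subgroup H (G i) \<and> B = free_product_incl G i ` H"
proof -
  let ?F = "free_product I G"
  interpret F: group ?F by (rule group_free_product)
  have B_one: "[] \<in> B" using subgroup.one_closed[OF B] by simp
  have B_sub: "b \<in> reduced_words I G" if "b \<in> B" for b using subgroup.subset[OF B] that by auto
  obtain b where b: "b \<in> B" "b \<noteq> []" using nontrivial B_one by blast
  then obtain i x where bx: "b = [(i, x)]" using short[of b] by (cases b) auto
  have x: "i \<in> I" "x \<in> carrier (G i)" "x \<noteq> \<one>\<^bsub>G i\<^esub>"
    using B_sub[OF b(1)] bx by (auto simp: Cons_reduced_words_iff)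
  interpret Gi: group "G i" using group_factor x by blast
  define H where "H = {h \<in> carrier (G i). free_product_incl G i h \<in> B}"
  have hom: "free_product_incl G i \<in> hom (G i) ?F" using free_product_incl_hom x by blast
  then interpret incl: group_hom "G i" ?F "free_product_incl G i"
    by unfold_locales
  have "subgroup H (G i)"
  proof (rule Gi.subgroupI)
    show "H \<noteq> {}" using B_one Gi.one_closed by (auto simp: H_def free_product_incl_def)
    show "inv\<^bsub>G i\<^esub> h \<in> H" if "h \<in> H" for h
      using that incl.hom_inv[of h] subgroup.m_inv_closed[OF B] by (auto simp: H_def)
    show "h \<otimes>\<^bsub>G i\<^esub> k \<in> H" if "h \<in> H" "k \<in> H" for h k
      using that incl.hom_mult[of h k] subgroup.m_closed[OF B] unfolding H_def
      by (metis (no_types, lifting) Gi.m_closed mem_Collect_eq)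
  qed (auto simp: H_def)
  moreover have "B \<subseteq> free_product_incl G i ` H"
  proof
    fix c assume c: "c \<in> B"
    show "c \<in> free_product_incl G i ` H"
    proof (cases c)
      case Nil
      then show ?thesis using B_one Gi.one_closed
        by (intro image_eqI[of _ _ "\<one>\<^bsub>G i\<^esub>"]) (auto simp: H_def free_product_incl_def)
    next
      case (Cons t v)
      then obtain j y where cy: "c = [(j, y)]" using short[OF c] by (cases t) auto
      have y: "y \<in> carrier (G j)" "y \<noteq> \<one>\<^bsub>G j\<^esub>"
        using B_sub[OF c] cy by (auto simp: Cons_reduced_words_iff)
      have "b \<otimes>\<^bsub>?F\<^esub> c \<in> B" using subgroup.m_closed[OF B b(1) c] .
      then have "length (b \<otimes>\<^bsub>?F\<^esub> c) \<le> 1" using short by blast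
      then have "i = j" using bx cy x by (auto split: if_splits)
      then show ?thesis using cy c y
        by (intro image_eqI[of _ _ y]) (auto simp: H_def free_product_incl_def)
    qed
  qed
  ultimately show ?thesis using x by (intro bexI[of _ i] exI[of _ H]) (auto simp: H_def)
qed

end

section \<open>Infinite systems of equations and continuity\<close>

text \<open>
  The sequences in \<open>K\<close> that satisfy the first \<open>m\<close> equations form a decreasing sequence of closed
  sets in a compact product space. They are nonempty since one may start with any element of
  \<open>V m\<close> and compute backwards; the inclusions between the sets \<open>V n\<close> keep this inside \<open>K\<close>.
\<close>
lemma compact_inverse_sequence:
  assumes X: "Hausdorff_space X" and K: "compactin X K"
    and V: "\<And>n. V n \<subseteq> K" "\<And>n. V n \<noteq> {}"
    and f: "\<And>n. continuous_map X X (f n)" "\<And>n. f n ` V (Suc n) \<subseteq> V n"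
  obtains y :: "nat \<Rightarrow> 'a" where "\<And>n. y n \<in> K" "\<And>n. y n = f n (y (Suc n))"
proof -
  let ?S = "subtopology X K"
  let ?P = "product_topology (\<lambda>_::nat. ?S) UNIV"
  have KX: "K \<subseteq> topspace X" using K compactin_subset_topspace by blast
  have top: "topspace ?P = {y. \<forall>n. y n \<in> K}" using KX by (auto simp: PiE_UNIV_domain)
  define C where "C m = {y \<in> topspace ?P. \<forall>n<m. y n = f n (y (Suc n))}" for m
  have "compact_space ?P"
    using K by (simp add: compact_space_product_topology compact_space_subtopology)
  moreover have "closedin ?P (C m)" for m
  proof -
    have proj: "continuous_map ?P X (\<lambda>y. y n)" for n
      using continuous_map_product_projection[of n UNIV "\<lambda>_. ?S"] continuous_map_into_fulltopology by auto
    have "closedin ?P {y \<in> topspace ?P. y n = f n (y (Suc n))}" for n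
      using closedin_continuous_maps_eq[OF X proj[of n] continuous_map_compose[OF proj[of "Suc n"] f(1)[of n]]]
      by (simp add: o_def)
    then have "closedin ?P (\<Inter>n<m. {y \<in> topspace ?P. y n = f n (y (Suc n))})" if "m \<noteq> 0"
      using that by (intro closedin_INT) auto
    moreover have "C m = (\<Inter>n<m. {y \<in> topspace ?P. y n = f n (y (Suc n))})" if "m \<noteq> 0"
      using that by (auto simp: C_def)
    moreover have "closedin ?P (C m)" if "m = 0"
    proof -
      have "C m = topspace ?P" using that by (simp add: C_def)
      then show ?thesis using closedin_topspace[of ?P] by (rule ssubst)
    qed
    ultimately show ?thesis by (cases "m = 0") auto
  qed
  moreover have "C m \<noteq> {}" for m
  proof -
    have *: "\<exists>y. y m = v \<and> (\<forall>n. y n \<in> K) \<and> (\<forall>n<m. y n = f n (y (Suc n)))" if "v \<in> V m" for v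
      using that
    proof (induction m arbitrary: v)
      case 0
      then show ?case using V by (intro exI[of _ "\<lambda>_. v"]) auto
    next
      case (Suc m)
      have "f m v \<in> V m" using f(2)[of m] Suc.prems by blast
      from Suc.IH[OF this] obtain y where
        y: "y m = f m v" "\<And>n. y n \<in> K" "\<And>n. n < m \<Longrightarrow> y n = f n (y (Suc n))" by blast
      show ?case
        using y V(1)[of "Suc m"] Suc.prems
        by (intro exI[of _ "y(Suc m := v)"]) (auto simp: less_Suc_eq)
    qed
    obtain v where "v \<in> V m" using V(2) by blast
    from *[OF this] show ?thesis unfolding C_def top by blast
  qed
  moreover have "decseq C" by (auto simp: decseq_def C_def)
  ultimately have "(\<Inter>m. C m) \<noteq> {}" by (rule compact_space_imp_nest)
  then obtain y where "\<And>m. y \<in> C m" by blast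
  then show thesis by (intro that[of y]) (auto simp: C_def top)
qed


context topological_group begin

lemma continuous_map_group_mult:
  assumes "continuous_map X T f" "continuous_map X T g"
  shows "continuous_map X T (\<lambda>x. f x \<otimes> g x)"
  using continuous_map_compose[OF continuous_map_pairedI[OF assms] continuous_mult]
  by (simp add: o_def)

lemma continuous_map_group_pow:
  assumes "continuous_map X T f"
  shows "continuous_map X T (\<lambda>x. f x [^] (n::nat))"
  by (induction n) (simp_all add: continuous_map_group_mult assms topspace_eq)

lemma continuous_map_conj:
  assumes "a \<in> carrier L" "b \<in> carrier L"
  shows "continuous_map T T (\<lambda>x. a \<otimes> x \<otimes> b)"
  using assms by (intro continuous_map_group_mult) (simp_all add: topspace_eq)

lemma continuous_discrete_if_open_kernel:
  assumes F: "group F" and \<phi>: "\<phi> \<in> hom L F"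
    and W: "openin T W" "\<one> \<in> W" "\<phi> ` W \<subseteq> {\<one>\<^bsub>F\<^esub>}"
  shows "continuous_map T (discrete_topology (carrier F)) \<phi>"
proof -
  interpret \<phi>: group_hom L F \<phi>
    using F \<phi> is_group by (simp add: group_hom_def group_hom_axioms_def)
  have "openin T {x \<in> topspace T. \<phi> x \<in> S}" for S
    unfolding openin_subopen[of T "{x \<in> topspace T. \<phi> x \<in> S}"]
  proof
    fix x assume "x \<in> {x \<in> topspace T. \<phi> x \<in> S}"
    then have x: "x \<in> carrier L" "\<phi> x \<in> S" by (auto simp: topspace_eq)
    let ?N = "{y \<in> topspace T. inv x \<otimes> y \<otimes> \<one> \<in> W}"
    have "openin T ?N"
      using openin_continuous_map_preimage[OF continuous_map_conj W(1), of "inv x" \<one>] x by simp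
    moreover have "x \<in> ?N" using x W(2) by (simp add: topspace_eq)
    moreover have "?N \<subseteq> {x \<in> topspace T. \<phi> x \<in> S}"
    proof
      fix y assume that: "y \<in> ?N"
      have y: "y \<in> carrier L" "inv x \<otimes> y \<in> W" using that x by (auto simp: topspace_eq)
      then have "\<phi> (inv x \<otimes> y) = \<one>\<^bsub>F\<^esub>" using W(3) by blast
      then have "inv\<^bsub>F\<^esub> \<phi> x \<otimes>\<^bsub>F\<^esub> \<phi> y = \<one>\<^bsub>F\<^esub>" using x y by (simp add: \<phi>.hom_mult)
      then have "\<phi> y = \<phi> x" using x y \<phi>.H.inv_solve_left'[of "\<one>\<^bsub>F\<^esub>" "\<phi> x" "\<phi> y"] by simp
      then show "y \<in> {x \<in> topspace T. \<phi> x \<in> S}" using x y by (simp add: topspace_eq)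
    qed
    ultimately show "\<exists>N. openin T N \<and> x \<in> N \<and> N \<subseteq> {x \<in> topspace T. \<phi> x \<in> S}"
      by blast
  qed
  then show ?thesis by (auto simp: continuous_map_def topspace_eq)
qed

end

locale hom_to_tree_length_group =
  L: locally_compact_group L T + F: tree_length_group F len + \<phi>: group_hom L F \<phi>
  for L :: "('l, 'm) monoid_scheme" (structure) and T and F :: "('a, 'b) monoid_scheme"
    and len and \<phi>
begin

text \<open>
  The second alternative says that \<open>p\<close> is an orbit point at distance \<open>1/2\<close> from a vertex fixed by
  the image of \<open>\<phi>\<close>.
\<close>
lemma open_kernel_or_fixed_point:
  assumes U: "openin T U" "\<one> \<in> U" "\<And>x. x \<in> U \<Longrightarrow> \<not> F.hyperbolic (\<phi> x)"
  shows "(\<exists>W. openin T W \<and> \<one> \<in> W \<and> \<phi> ` W \<subseteq> {\<one>\<^bsub>F\<^esub>}) \<or>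
    (\<exists>p \<in> carrier F. \<forall>l \<in> carrier L. len (inv\<^bsub>F\<^esub> p \<otimes>\<^bsub>F\<^esub> \<phi> l \<otimes>\<^bsub>F\<^esub> p) \<le> 1)"
proof (subst disj_imp, rule impI)
  assume no_kernel: "\<not> (\<exists>W. openin T W \<and> \<one> \<in> W \<and> \<phi> ` W \<subseteq> {\<one>\<^bsub>F\<^esub>})"
  have nontrivial: "\<exists>x \<in> W. \<phi> x \<noteq> \<one>\<^bsub>F\<^esub>" if "openin T W" "\<one> \<in> W" for W
    using no_kernel that by blast
  obtain V where V: "openin T V" "\<one> \<in> V" "\<And>x y. \<lbrakk>x \<in> V; y \<in> V\<rbrakk> \<Longrightarrow> x \<otimes> y \<in> U"
  proof -
    have "openin (prod_topology T T) {p \<in> topspace (prod_topology T T). (\<lambda>(x, y). x \<otimes> y) p \<in> U}"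
      using openin_continuous_map_preimage[OF L.continuous_mult U(1)] .
    moreover have "(\<one>, \<one>) \<in> {p \<in> topspace (prod_topology T T). (\<lambda>(x, y). x \<otimes> y) p \<in> U}"
      using U(2) by (simp add: L.topspace_eq)
    ultimately have "\<exists>A B. openin T A \<and> openin T B \<and> \<one> \<in> A \<and> \<one> \<in> B \<and>
        A \<times> B \<subseteq> {p \<in> topspace (prod_topology T T). (\<lambda>(x, y). x \<otimes> y) p \<in> U}"
      unfolding openin_prod_topology_alt by (elim allE impE)
    then obtain A B where AB: "openin T A" "openin T B" "\<one> \<in> A" "\<one> \<in> B"
      "A \<times> B \<subseteq> {p \<in> topspace (prod_topology T T). (\<lambda>(x, y). x \<otimes> y) p \<in> U}"
      by blast
    have "x \<otimes> y \<in> U" if "x \<in> A \<inter> B" "y \<in> A \<inter> B" for x y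
      using AB(5) that by auto
    then show thesis using AB by (intro that[of "A \<inter> B"]) auto
  qed
  have V_sub: "x \<in> carrier L" "x \<in> U" if "x \<in> V" for x
  proof -
    show x: "x \<in> carrier L" using openin_subset[OF V(1)] that by (auto simp: L.topspace_eq)
    show "x \<in> U" using V(3)[OF that V(2)] x by simp
  qed
  obtain x where x: "x \<in> V" "\<phi> x \<noteq> \<one>\<^bsub>F\<^esub>" using nontrivial V by blast
  have \<phi>x: "\<phi> x \<in> carrier F" "\<not> F.hyperbolic (\<phi> x)" using V_sub[OF x(1)] U(3) by auto
  obtain p where p: "p \<in> carrier F" "len (inv\<^bsub>F\<^esub> p \<otimes>\<^bsub>F\<^esub> \<phi> x \<otimes>\<^bsub>F\<^esub> p) \<le> len (\<phi> x) mod 2"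
    using F.elliptic_fixed_point[OF \<phi>x] by blast
  define c where "c y = inv\<^bsub>F\<^esub> p \<otimes>\<^bsub>F\<^esub> y \<otimes>\<^bsub>F\<^esub> p" for y
  have c_closed: "c y \<in> carrier F" if "y \<in> carrier F" for y using that p by (simp add: c_def)
  have c_mult: "c (y \<otimes>\<^bsub>F\<^esub> z) = c y \<otimes>\<^bsub>F\<^esub> c z" if "y \<in> carrier F" "z \<in> carrier F" for y z
    using that p by (simp add: c_def F.m_assoc)
  have c_hyp: "F.hyperbolic (c y) \<longleftrightarrow> F.hyperbolic y" if "y \<in> carrier F" for y
    using F.hyperbolic_conj_iff[of y "inv\<^bsub>F\<^esub> p"] that p by (simp add: c_def)
  have c_len: "1 \<le> len (c y)" if "y \<in> carrier F" "y \<noteq> \<one>\<^bsub>F\<^esub>" for y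
  proof -
    have "c y \<noteq> \<one>\<^bsub>F\<^esub>"
    proof
      assume "c y = \<one>\<^bsub>F\<^esub>"
      then have "p \<otimes>\<^bsub>F\<^esub> c y \<otimes>\<^bsub>F\<^esub> inv\<^bsub>F\<^esub> p = \<one>\<^bsub>F\<^esub>" using p by simp
      then show False using that p by (simp add: c_def F.m_assoc)
    qed
    then show ?thesis using F.len_eq_0_iff[of "c y"] F.len_nonneg[of "c y"] c_closed[OF that(1)] by linarith
  qed
  have "len (c (\<phi> x)) = 1"
    using c_len[OF \<phi>x(1) x(2)] p(2) pos_mod_bound[of 2 "len (\<phi> x)"] unfolding c_def by linarith
  then have V_short: "len (c (\<phi> y)) \<le> 1" if y: "y \<in> V" for y
  proof -
    have xy: "\<phi> y \<in> carrier F" "\<phi> (x \<otimes> y) = \<phi> x \<otimes>\<^bsub>F\<^esub> \<phi> y" "\<not> F.hyperbolic (\<phi> y)"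
      using V_sub[OF x(1)] V_sub[OF y] U(3) by simp_all
    have "\<not> F.hyperbolic (\<phi> (x \<otimes> y))" using U(3) V(3)[OF x(1) y] by blast
    then have "\<not> F.hyperbolic (c (\<phi> x) \<otimes>\<^bsub>F\<^esub> c (\<phi> y))" "\<not> F.hyperbolic (c (\<phi> y))"
      using c_hyp[of "\<phi> x \<otimes>\<^bsub>F\<^esub> \<phi> y"] c_hyp[of "\<phi> y"] c_mult[of "\<phi> x" "\<phi> y"] \<phi>x xy by simp_all
    then show ?thesis
      using F.elliptic_common_fixed_point \<open>len (c (\<phi> x)) = 1\<close> c_closed xy \<phi>x by blast
  qed
  have "len (c (\<phi> l)) \<le> 1" if l: "l \<in> carrier L" for l
  proof -
    let ?W = "V \<inter> {y \<in> topspace T. inv l \<otimes> y \<otimes> l \<in> V}"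
    have "openin T ?W"
      using openin_continuous_map_preimage[OF L.continuous_map_conj V(1), of "inv l" l] l V(1) by auto
    moreover have "\<one> \<in> ?W" using V(2) l by (simp add: L.topspace_eq)
    ultimately obtain y where y: "y \<in> V" "inv l \<otimes> y \<otimes> l \<in> V" "\<phi> y \<noteq> \<one>\<^bsub>F\<^esub>"
      using nontrivial by blast
    let ?b = "c (\<phi> y)" and ?q = "c (\<phi> l)"
    have yL: "y \<in> carrier L" using V_sub y by blast
    have bq: "?b \<in> carrier F" "?q \<in> carrier F" using c_closed yL l by auto
    have b: "len ?b = 1" using V_short[OF y(1)] c_len[of "\<phi> y"] yL y(3) by simp
    have "\<phi> (inv l \<otimes> y \<otimes> l) = inv\<^bsub>F\<^esub> \<phi> l \<otimes>\<^bsub>F\<^esub> \<phi> y \<otimes>\<^bsub>F\<^esub> \<phi> l" using yL l by simp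
    then have "c (\<phi> (inv l \<otimes> y \<otimes> l)) = inv\<^bsub>F\<^esub> ?q \<otimes>\<^bsub>F\<^esub> (?b \<otimes>\<^bsub>F\<^esub> ?q)"
      using yL l p by (simp add: c_def F.group_rules)
    then have "len (inv\<^bsub>F\<^esub> ?q \<otimes>\<^bsub>F\<^esub> (?b \<otimes>\<^bsub>F\<^esub> ?q)) \<le> 1" using V_short[OF y(2)] by simp
    then show ?thesis
      using F.len_syllable[OF bq b] F.len_mult_ge(2)[OF bq] b by linarith
  qed
  then show "\<exists>p \<in> carrier F. \<forall>l \<in> carrier L. len (inv\<^bsub>F\<^esub> p \<otimes>\<^bsub>F\<^esub> \<phi> l \<otimes>\<^bsub>F\<^esub> p) \<le> 1"
    using p(1) unfolding c_def by blast
qed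

text \<open>
  The choices are organised by pairs \<open>A n\<close>, consisting of a running total of the growth constants
  and a neighbourhood of the identity in which \<open>y\<^sub>n\<close> is allowed to vary. The exponent \<open>r\<^sub>n\<close> exceeds
  by at least \<open>n\<close> a total that already includes the constant of the \<open>n\<close>-th word; this is possible as that
  constant does not depend on \<open>r\<^sub>n\<close>.
\<close>
lemma nonhyperbolic_neighbourhood:
  "\<exists>U. openin T U \<and> \<one> \<in> U \<and> (\<forall>x \<in> U. \<not> F.hyperbolic (\<phi> x))"
proof (rule ccontr)
  assume contra: "\<not> ?thesis"
  have hyp: "\<exists>x \<in> U. F.hyperbolic (\<phi> x)" if "openin T U" "\<one> \<in> U" for U
    using that contra by blast
  define w where "w x r y = x [^] (20::nat) \<otimes> y [^] r \<otimes> (x [^] (10::nat) \<otimes> y [^] r)" for x y and r :: nat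
  have w_cont: "continuous_map T T (w x r)" if "x \<in> carrier L" for x r
    unfolding w_def using that
    by (intro L.continuous_map_group_mult L.continuous_map_group_pow) (simp_all add: L.topspace_eq)
  have \<phi>w: "\<phi> (w x r y) = F.test_word (\<phi> x) r (\<phi> y)" if "x \<in> carrier L" "y \<in> carrier L" for x r y
    using that by (simp add: w_def F.test_word_def \<phi>.hom_nat_pow)
  have "\<one> \<in> topspace T" by (simp add: L.topspace_eq)
  then obtain O0 K where K: "openin T O0" "compactin T K" "\<one> \<in> O0" "O0 \<subseteq> K"
    using L.locally_compact unfolding locally_compact_space_def by meson
  define good where "good n A x r B \<longleftrightarrow> x \<in> carrier L \<and>
      w x r ` (snd B) \<subseteq> snd A \<and> fst B + n \<le> r \<and>
      (\<forall>h \<in> carrier F. F.hyperbolic (F.test_word (\<phi> x) r h)) \<and>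
      (\<forall>h \<in> carrier F. F.hyperbolic h \<longrightarrow>
         max (len h) (int r) \<le> len (F.test_word (\<phi> x) r h) + int (fst B) - int (fst A))"
    for n r :: nat and x and A B :: "nat \<times> 'l set"
  have "\<exists>A :: nat \<Rightarrow> nat \<times> 'l set. \<forall>n. (openin T (snd (A n)) \<and> \<one> \<in> snd (A n) \<and> snd (A n) \<subseteq> K) \<and>
      (\<exists>x r. good n (A n) x r (A (Suc n)))"
  proof (rule dependent_nat_choice)
    show "\<exists>A :: nat \<times> 'l set. openin T (snd A) \<and> \<one> \<in> snd A \<and> snd A \<subseteq> K"
      using K by (intro exI[of _ "(0 :: nat, O0)"]) simp
  next
    fix A :: "nat \<times> 'l set" and n
    assume A: "openin T (snd A) \<and> \<one> \<in> snd A \<and> snd A \<subseteq> K"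
    \<comment> \<open>the value at \<open>y = 1\<close> does not depend on the exponent, which can be chosen after \<open>x\<close>\<close>
    let ?U = "{x \<in> topspace T. w x 0 \<one> \<in> snd A}"
    have "continuous_map T T (\<lambda>x. w x 0 \<one>)"
      unfolding w_def by (intro L.continuous_map_group_mult L.continuous_map_group_pow) (simp_all add: L.topspace_eq)
    then have "openin T ?U" using openin_continuous_map_preimage A by blast
    moreover have "\<one> \<in> ?U" using A by (simp add: w_def L.topspace_eq)
    ultimately obtain x where x: "x \<in> carrier L" "w x 0 \<one> \<in> snd A" "F.hyperbolic (\<phi> x)"
      using hyp L.topspace_eq by blast
    obtain C where C: "\<And>r h. \<lbrakk>C \<le> r; h \<in> carrier F\<rbrakk> \<Longrightarrow> F.hyperbolic (F.test_word (\<phi> x) r h)"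
      "\<And>r h. \<lbrakk>C \<le> r; h \<in> carrier F; F.hyperbolic h\<rbrakk> \<Longrightarrow>
        max (len h) (int r) \<le> len (F.test_word (\<phi> x) r h) + int C"
      by (rule F.test_word_growth[OF \<phi>.hom_closed[OF x(1)] x(3)]) (rule that)
    let ?r = "fst A + C + n"
    let ?B = "(fst A + C, snd A \<inter> {y \<in> topspace T. w x ?r y \<in> snd A})"
    have "openin T (snd ?B)"
      using openin_continuous_map_preimage[OF w_cont[OF x(1)]] A by auto
    moreover have "\<one> \<in> snd ?B" using A x by (simp add: w_def L.topspace_eq)
    moreover have "snd ?B \<subseteq> K" using A by auto
    moreover have "good n A x ?r ?B"
      using x C[of ?r] by (auto simp: good_def)
    ultimately show "\<exists>B. (openin T (snd B) \<and> \<one> \<in> snd B \<and> snd B \<subseteq> K) \<and> (\<exists>x r. good n A x r B)"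
      by blast
  qed
  then obtain A where A: "\<And>n. \<one> \<in> snd (A n)" "\<And>n. snd (A n) \<subseteq> K"
    "\<And>n. \<exists>x r. good n (A n) x r (A (Suc n))" by blast
  then obtain x r where good: "\<And>n. good n (A n) (x n) (r n) (A (Suc n))" by metis
  have xL: "x n \<in> carrier L" for n using good[of n] by (simp add: good_def)
  have nonempty: "snd (A n) \<noteq> {}" for n using A(1) by blast
  have maps: "w (x n) (r n) ` snd (A (Suc n)) \<subseteq> snd (A n)" for n using good[of n] by (simp add: good_def)
  obtain y where y: "\<And>n. y n \<in> K" "\<And>n. y n = w (x n) (r n) (y (Suc n))"
    by (rule compact_inverse_sequence[OF L.Hausdorff K(2), of "\<lambda>n. snd (A n)" "\<lambda>n. w (x n) (r n)",
          OF A(2) nonempty w_cont[OF xL] maps]) (rule that)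
  have yL: "y n \<in> carrier L" for n
    using y(1) compactin_subset_topspace[OF K(2)] L.topspace_eq by blast
  define h where "h n = \<phi> (y n)" for n
  have hF: "h n \<in> carrier F" for n using yL by (simp add: h_def)
  have h: "h n = F.test_word (\<phi> (x n)) (r n) (h (Suc n))" for n
    unfolding h_def using y(2)[of n] \<phi>w[OF xL yL] by metis
  have h_hyp: "F.hyperbolic (h n)" for n
    using good[of n] hF[of "Suc n"] h[of n] by (simp add: good_def)
  have step: "max (len (h (Suc n))) (int (r n)) \<le> len (h n) + int (fst (A (Suc n))) - int (fst (A n))" for n
    using good[of n] hF[of "Suc n"] h_hyp[of "Suc n"] h[of n] by (simp add: good_def)
  have chain: "len (h n) \<le> len (h 0) + int (fst (A n)) - int (fst (A 0))" for n
  proof (induction n)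
    case (Suc n)
    then show ?case using step[of n] by simp
  qed simp
  have "int n \<le> len (h 0)" for n
  proof -
    have "fst (A (Suc n)) + n \<le> r n" using good[of n] by (simp add: good_def)
    then show ?thesis using step[of n] chain[of n] by simp
  qed
  from this[of "nat (len (h 0) + 1)"] show False using F.len_nonneg[OF hF[of 0]] by simp
qed

end

theorem corollaryB:
  fixes L :: "('l, 'm) monoid_scheme"
    and T :: "'l topology"
    and I :: "'i set"
    and G :: "'i \<Rightarrow> ('a, 'b) monoid_scheme"
    and \<phi> :: "'l \<Rightarrow> ('i \<times> 'a) list"
  assumes "locally_compact_group L T"
    and "\<And>i. i \<in> I \<Longrightarrow> group (G i)"
    and "\<phi> \<in> hom L (free_product I G)"
  shows "continuous_map T (discrete_topology (carrier (free_product I G))) \<phi> \<or>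
    (\<exists>i \<in> I. \<exists>H g. subgroup H (G i) \<and> g \<in> carrier (free_product I G) \<and>
       \<phi> ` carrier L =
         (g <#\<^bsub>free_product I G\<^esub> (free_product_incl G i ` H))
           #>\<^bsub>free_product I G\<^esub> (inv\<^bsub>free_product I G\<^esub> g))"
proof -
  let ?F = "free_product I G"
  interpret group_family I G using assms(2) by (simp add: group_family_def)
  interpret F: tree_length_group ?F "\<lambda>w. int (length w)" by (rule tree_length_free_product)
  interpret L: locally_compact_group L T by fact
  interpret \<phi>: group_hom L ?F \<phi> using assms(3) by unfold_locales
  interpret hom_to_tree_length_group L T ?F "\<lambda>w. int (length w)" \<phi> by unfold_locales
  obtain U where U: "openin T U" "\<one>\<^bsub>L\<^esub> \<in> U" "\<And>x. x \<in> U \<Longrightarrow> \<not> F.hyperbolic (\<phi> x)"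
    using nonhyperbolic_neighbourhood by blast
  consider (kernel) W where "openin T W" "\<one>\<^bsub>L\<^esub> \<in> W" "\<phi> ` W \<subseteq> {\<one>\<^bsub>?F\<^esub>}"
    | (fixed) p where "p \<in> carrier ?F"
      "\<And>l. l \<in> carrier L \<Longrightarrow> length (inv\<^bsub>?F\<^esub> p \<otimes>\<^bsub>?F\<^esub> \<phi> l \<otimes>\<^bsub>?F\<^esub> p) \<le> 1"
    using open_kernel_or_fixed_point[OF U] by (auto simp del: free_product_simps)
  then show ?thesis
  proof cases
    case kernel
    then show ?thesis
      using L.continuous_discrete_if_open_kernel[OF F.is_group assms(3)] by blast
  next
    case fixed
    note [simp del] = free_product_simps
    define c where "c y = inv\<^bsub>?F\<^esub> p \<otimes>\<^bsub>?F\<^esub> y \<otimes>\<^bsub>?F\<^esub> p" for y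
    define B where "B = (\<lambda>l. c (\<phi> l)) ` carrier L"
    have "(\<lambda>l. c (\<phi> l)) \<in> hom L ?F"
      using fixed(1) by (intro homI) (simp_all add: c_def F.m_assoc)
    then interpret c\<phi>: group_hom L ?F "\<lambda>l. c (\<phi> l)" by unfold_locales
    have B: "subgroup B ?F" unfolding B_def by (rule c\<phi>.img_is_subgroup)
    have conj_c: "p \<otimes>\<^bsub>?F\<^esub> c y \<otimes>\<^bsub>?F\<^esub> inv\<^bsub>?F\<^esub> p = y" if "y \<in> carrier ?F" for y
      using that fixed(1) by (simp add: c_def F.m_assoc)
    have image: "\<phi> ` carrier L = (p <#\<^bsub>?F\<^esub> B) #>\<^bsub>?F\<^esub> inv\<^bsub>?F\<^esub> p"
      unfolding l_coset_def r_coset_def B_def using conj_c by (auto simp: image_iff)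
    show ?thesis
    proof (cases "B = {[]}")
      \<comment> \<open>if the image is trivial there may be no factor at all, as \<open>I\<close> can be empty\<close>
      case True
      have "\<phi> ` carrier L \<subseteq> {\<one>\<^bsub>?F\<^esub>}"
        using image fixed(1) unfolding True l_coset_def r_coset_def
        by (simp add: F.r_one flip: free_product_simps(3)[of I G])
      then have "continuous_map T (discrete_topology (carrier ?F)) \<phi>"
        using openin_topspace[of T]
        by (intro L.continuous_discrete_if_open_kernel[OF F.is_group assms(3), of "topspace T"])
          (simp_all only: L.topspace_eq L.one_closed)
      then show ?thesis ..
    next
      case False
      have "length b \<le> 1" if "b \<in> B" for b using that fixed(2) by (auto simp: B_def c_def)
      from short_subgroup_in_factor[OF B this False] show ?thesis
        using image fixed(1) by metis
    qed
  qed
qed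

end
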